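(* Let $\mathcal G$ be a time-invariant communication graph on $N$ nodes with adjacency matrix $A=(a_{kj})$ and Laplacian $L$, and let $\phi:\mathbb R^d\to\mathbb R$ be globally Lipschitz. Suppose that: (1) the graph $\mathcal G$ is connected; (2) there exists a nonempty compact set $W\subset\mathbb R^d$, invariant for $\dot w=Sw+B\phi(w)$, such that the system $\dot w = Sw+B\phi(w)+v$ is input-to-state stable with respect to $v$ relative to $W$. Let $\mu>0$ be such that $\mathrm{Re}[\lambda_i(L)]\ge\mu$ for $i=2,\dots,N$, let $a>0$, let $P$ be the unique positive definite symmetric solution of the algebraic Riccati equation $$SP+PS^T-2\mu PC^TCP+aI=0,$$ and set $K_0=PC^T$. For $g>0$ let $D_g=\mathrm{diag}(g,g^2,\dots,g^d)$ and consider the network of $N$ coupled systems $$\dot w_k=Sw_k+B\phi(w_k)+D_gK_0\sum_{j=1}^N a_{kj}(Cw_j-Cw_k),\qquad k=1,\dots,N,$$ with $w_k\in\mathbb R^d$. Then there exists a number $g^\ast>0$ such that, for all $g\ge g^\ast$, the compact invariant set $$\mathbf W=\{(w_1,w_2,\dots,w_N)\in W\times W\times\cdots\times W:\ w_1=w_2=\cdots=w_N\}$$ is globally asymptotically stable for this network.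
   Context: Communication graph: a triplet $\mathcal G=\{\mathcal V,\mathcal E,A\}$ with vertices $\mathcal V=\{v_1,\dots,v_N\}$, edges $\mathcal E\subset\mathcal V\times\mathcal V$, where $(v_k,v_j)\in\mathcal E$ means that information flows from node $j$ to node $k$, and adjacency matrix $A=(a_{kj})\in\mathbb R^{N\times N}$ with constant nonnegative entries, $a_{kj}$ weighting the flow from node $j$ to node $k$ (so $a_{kj}\neq0$ exactly when $(v_k,v_j)\in\mathcal E$). There are no self-loops: $(v_k,v_k)\notin\mathcal E$. A path from $v_j$ to $v_k$ is a sequence of distinct nodes $v_{\ell_1},\dots,v_{\ell_r}$ with $v_{\ell_1}=v_j$, $v_{\ell_r}=v_k$ and $(v_{\ell_{i+1}},v_{\ell_i})\in\mathcal E$ for each $i$. The graph is connected if there is a node $v$ such that for every other node $v_k\in\mathcal V\setminus\{v\}$ there is a path from $v$ to $v_k$. Laplacian: $L=(\ell_{kj})$ with $\ell_{kj}=-a_{kj}$ for $k\ne j$ and $\ell_{kk}=\sum_{i=1}^N a_{ki}$. The vector $1_N$ of all ones is an eigenvector of $L$ for the eigenvalue $0$; the other $N-1$ eigenvalues are denoted $\lambda_2(L),\dots,\lambda_N(L)$. The graph is connected if and only if these all have positive real part, so a $\mu$ as in the claim exists. Prime form: $(S,B,C)$ is the triplet with $S\in\mathbb R^{d\times d}$ having ones on the first superdiagonal and zeros elsewhere, $B=(0,\dots,0,1)^T\in\mathbb R^{d\times1}$ and $C=(1,0,\dots,0)\in\mathbb R^{1\times d}$. Input-to-state stability relative to $W$: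 writing $\|w\|_W$ for the distance of $w$ from $W$ and $w(t,\bar w)$ for the solution of $\dot w=Sw+B\phi(w)+v$ with initial condition $\bar w$ and input $v(\cdot)$, there exist a class-$\mathcal{KL}$ function $\beta$ and a class-$\mathcal K$ function $\gamma$ such that $\|w(t,\bar w)\|_W\le\max\{\beta(\|\bar w\|_W,t),\ \gamma(\sup_{\tau\in[0,t)}\|v(\tau)\|)\}$ for all $\bar w\in\mathbb R^d$, all inputs $v$ and all $t\ge0$. *)

theory Defs
  imports
    "HOL-Analysis.Analysis"
    "HOL-Computational_Algebra.Computational_Algebra"
begin

section \<open>Communication graphs\<close>

text \<open>
  The node set is the finite type \<open>'n\<close>. A pair \<open>(k, j)\<close> in the edge set means that
  information flows from \<open>j\<close> to \<open>k\<close>.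
\<close>

definition comm_graph :: "('n::finite \<times> 'n) set \<Rightarrow> real^'n^'n \<Rightarrow> bool" where
  "comm_graph E A \<longleftrightarrow>
     (\<forall>k j. 0 \<le> A $ k $ j) \<and>
     (\<forall>k j. A $ k $ j \<noteq> 0 \<longleftrightarrow> (k, j) \<in> E) \<and>
     (\<forall>k. (k, k) \<notin> E)"

definition path_from_to :: "('n \<times> 'n) set \<Rightarrow> 'n \<Rightarrow> 'n \<Rightarrow> 'n list \<Rightarrow> bool" where
  "path_from_to E j k ls \<longleftrightarrow>
     ls \<noteq> [] \<and> distinct ls \<and> hd ls = j \<and> last ls = k \<and>
     (\<forall>i. Suc i < length ls \<longrightarrow> (ls ! Suc i, ls ! i) \<in> E)"

definition graph_connected :: "('n \<times> 'n) set \<Rightarrow> bool" where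
  "graph_connected E \<longleftrightarrow> (\<exists>v. \<forall>k. k \<noteq> v \<longrightarrow> (\<exists>ls. path_from_to E v k ls))"

definition laplacian :: "real^'n^'n \<Rightarrow> real^'n^('n::finite)" where
  "laplacian A = (\<chi> k j. if k = j then (\<Sum>i\<in>UNIV. A $ k $ i) else - A $ k $ j)"

definition charpoly :: "complex^'n^'n \<Rightarrow> complex poly" where
  "charpoly M = det (mat [:0, 1:] - map_matrix (\<lambda>c. [:c:]) M)"

text \<open>Complex eigenvalues of a real matrix, counted with algebraic multiplicity.\<close>

definition eigenvalues :: "real^'n^'n \<Rightarrow> complex multiset" where
  "eigenvalues M = proots (charpoly (map_matrix complex_of_real M))"

text \<open>
  The eigenvalues \<open>\<lambda>\<^sub>2, \<dots>, \<lambda>\<^sub>N\<close>: one occurrence of the eigenvalue 0 (the one belonging to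
  the all-ones vector) is removed.
\<close>

definition other_eigenvalues :: "real^'n^'n \<Rightarrow> complex multiset" where
  "other_eigenvalues A = eigenvalues (laplacian A) - {#0#}"


section \<open>Prime form and gain matrices\<close>

text \<open>
  The coordinates \<open>1, \<dots>, d\<close> are the elements of a finite linearly ordered type \<open>'d\<close>;
  \<open>pos i\<close> is the position of \<open>i\<close>, so \<open>pos\<close> maps \<open>'d\<close> increasingly onto \<open>{1..CARD('d)}\<close>.
\<close>

definition pos :: "'d::{finite,linorder} \<Rightarrow> nat" where
  "pos i = card {..i}"

definition S_mat :: "real^('d::{finite,linorder})^('d::{finite,linorder})" where
  "S_mat = (\<chi> i j. if pos j = pos i + 1 then 1 else 0)"

definition B_mat :: "real^1^('d::{finite,linorder})" where
  "B_mat = (\<chi> i _. if pos i = CARD('d) then 1 else 0)"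

definition C_mat :: "real^('d::{finite,linorder})^1" where
  "C_mat = (\<chi> _ i. if pos i = 1 then 1 else 0)"

definition D_mat :: "real \<Rightarrow> real^('d::{finite,linorder})^('d::{finite,linorder})" where
  "D_mat g = (\<chi> i j. if i = j then g ^ pos i else 0)"

definition pos_def_symmetric :: "real^'d^'d \<Rightarrow> bool" where
  "pos_def_symmetric P \<longleftrightarrow> transpose P = P \<and> (\<forall>x. x \<noteq> 0 \<longrightarrow> 0 < x \<bullet> (P *v x))"


section \<open>Solutions, stability and input-to-state stability\<close>

text \<open>
  \<open>is_solution f v x0 x\<close>: on \<open>[0, \<infinity>)\<close> the function \<open>x\<close> solves \<open>x' = f x + v\<close>, \<open>x 0 = x0\<close>.
  The differential equation is required wherever the input \<open>v\<close> is continuous (everywhere,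
  if \<open>v\<close> is identically 0); at the jumps of \<open>v\<close> only continuity of \<open>x\<close> is required.
\<close>

definition is_solution ::
  "('a::real_normed_vector \<Rightarrow> 'a) \<Rightarrow> (real \<Rightarrow> 'a) \<Rightarrow> 'a \<Rightarrow> (real \<Rightarrow> 'a) \<Rightarrow> bool" where
  "is_solution f v x0 x \<longleftrightarrow>
     x 0 = x0 \<and> continuous_on {0..} x \<and>
     (\<forall>t\<ge>0. continuous (at t within {0..}) v \<longrightarrow>
        (x has_vector_derivative (f (x t) + v t)) (at t within {0..}))"

abbreviation is_free_solution ::
  "('a::real_normed_vector \<Rightarrow> 'a) \<Rightarrow> 'a \<Rightarrow> (real \<Rightarrow> 'a) \<Rightarrow> bool" where
  "is_free_solution f x0 x \<equiv> is_solution f (\<lambda>_. 0) x0 x"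

text \<open>
  Admissible inputs: piecewise continuous on \<open>[0, \<infinity>)\<close>, that is, finitely many discontinuities
  on every bounded interval, all of them jumps. Such inputs are bounded on bounded intervals.
\<close>

definition admissible_input :: "(real \<Rightarrow> 'a::real_normed_vector) \<Rightarrow> bool" where
  "admissible_input v \<longleftrightarrow>
     (\<forall>T. finite {t \<in> {0..T}. \<not> continuous (at t within {0..}) v}) \<and>
     (\<forall>t\<ge>0. \<exists>l. (v \<longlongrightarrow> l) (at_right t)) \<and>
     (\<forall>t>0. \<exists>l. (v \<longlongrightarrow> l) (at_left t))"

text \<open>Supremum taken in \<open>[0, \<infinity>)\<close>: inserting 0 only matters for \<open>t = 0\<close>, the empty supremum.\<close>

definition sup_norm_before :: "(real \<Rightarrow> 'a::real_normed_vector) \<Rightarrow> real \<Rightarrow> real" where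
  "sup_norm_before v t = Sup (insert 0 ((\<lambda>\<tau>. norm (v \<tau>)) ` {0..<t}))"

definition class_K :: "(real \<Rightarrow> real) \<Rightarrow> bool" where
  "class_K \<gamma> \<longleftrightarrow> continuous_on {0..} \<gamma> \<and> strict_mono_on {0..} \<gamma> \<and> \<gamma> 0 = 0"

definition class_KL :: "(real \<Rightarrow> real \<Rightarrow> real) \<Rightarrow> bool" where
  "class_KL \<beta> \<longleftrightarrow>
     continuous_on ({0..} \<times> {0..}) (\<lambda>(r, t). \<beta> r t) \<and>
     (\<forall>t\<ge>0. class_K (\<lambda>r. \<beta> r t)) \<and>
     (\<forall>r\<ge>0. antimono_on {0..} (\<beta> r) \<and> (\<beta> r \<longlongrightarrow> 0) at_top)"

text \<open>The distance of \<open>x\<close> from a nonempty set \<open>W\<close> is \<open>infdist x W\<close>.\<close>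

definition iss_relative :: "('a::real_normed_vector \<Rightarrow> 'a) \<Rightarrow> 'a set \<Rightarrow> bool" where
  "iss_relative f W \<longleftrightarrow>
     (\<exists>\<beta> \<gamma>. class_KL \<beta> \<and> class_K \<gamma> \<and>
        (\<forall>x0 v x. admissible_input v \<longrightarrow> is_solution f v x0 x \<longrightarrow>
           (\<forall>t\<ge>0. infdist (x t) W \<le> max (\<beta> (infdist x0 W) t) (\<gamma> (sup_norm_before v t)))))"

definition invariant_set :: "('a::real_normed_vector \<Rightarrow> 'a) \<Rightarrow> 'a set \<Rightarrow> bool" where
  "invariant_set f W \<longleftrightarrow>
     (\<forall>x0\<in>W. \<forall>x. is_free_solution f x0 x \<longrightarrow> (\<forall>t\<ge>0. x t \<in> W))"

text \<open>
  Global asymptotic stability of a set: trajectories exist for all \<open>t \<ge> 0\<close>, the set is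
  Lyapunov stable, and it attracts every trajectory.
\<close>

definition globally_asymptotically_stable ::
  "('a::real_normed_vector \<Rightarrow> 'a) \<Rightarrow> 'a set \<Rightarrow> bool" where
  "globally_asymptotically_stable f W \<longleftrightarrow>
     (\<forall>x0. \<exists>x. is_free_solution f x0 x) \<and>
     (\<forall>\<epsilon>>0. \<exists>\<delta>>0. \<forall>x0 x. is_free_solution f x0 x \<longrightarrow> infdist x0 W < \<delta> \<longrightarrow>
        (\<forall>t\<ge>0. infdist (x t) W < \<epsilon>)) \<and>
     (\<forall>x0 x. is_free_solution f x0 x \<longrightarrow> ((\<lambda>t. infdist (x t) W) \<longlongrightarrow> 0) at_top)"


section \<open>The network\<close>

definition agent_field ::
  "(real^('d::{finite,linorder}) \<Rightarrow> real) \<Rightarrow> real^('d::{finite,linorder}) \<Rightarrow> real^('d::{finite,linorder})" where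
  "agent_field \<phi> w = S_mat *v w + B_mat *v vec (\<phi> w)"

definition network_field ::
  "(real^('d::{finite,linorder}) \<Rightarrow> real) \<Rightarrow> real^'n^'n \<Rightarrow> real^1^('d::{finite,linorder}) \<Rightarrow> real \<Rightarrow>
   (real^('d::{finite,linorder}))^'n \<Rightarrow> (real^('d::{finite,linorder}))^('n::finite)" where
  "network_field \<phi> A K0 g w =
     (\<chi> k. agent_field \<phi> (w $ k) +
        (D_mat g ** K0) *v (\<Sum>j\<in>UNIV. A $ k $ j *\<^sub>R (C_mat *v (w $ j) - C_mat *v (w $ k))))"

definition sync_set :: "'a set \<Rightarrow> ('a^'n::finite) set" where
  "sync_set W = {w. (\<forall>k. w $ k \<in> W) \<and> (\<forall>j k. w $ j = w $ k)}"

end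

theory Submission
  imports Defs "HOL-Real_Asymp.Real_Asymp"
begin

text \<open>
  Relative to a reference node \<open>r\<close>, the errors \<open>w\<^sub>k - w\<^sub>r\<close> are governed by the deflated Laplacian
  \<open>M x = L x - (L x)\<^sub>r 1 + \<mu> x\<^sub>r 1\<close>, all of whose eigenvalues have real part at least \<open>\<mu>\<close>. Hence for
  every \<open>\<mu>' < \<mu>\<close> there is a positive definite form \<open>q x = \<Sum>\<^sub>m (u\<^sub>m \<bullet> x)\<^sup>2\<close> with
  \<open>\<Sum>\<^sub>m (u\<^sub>m \<bullet> x) (u\<^sub>m \<bullet> M x) \<ge> \<mu>' q x\<close>. In the coordinates \<open>\<eta>\<^sub>k = P\<inverse> D\<^sub>g\<inverse> (w\<^sub>k - w\<^sub>r)\<close> put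
  \<open>\<zeta>\<^sub>m = \<Sum>\<^sub>k u\<^sub>m\<^sub>k \<eta>\<^sub>k\<close> and \<open>V = \<Sum>\<^sub>m \<zeta>\<^sub>m \<bullet> P \<zeta>\<^sub>m\<close>. By the Riccati equation the linear part of the
  dynamics contributes at most \<open>- g (a/2) \<Sum>\<^sub>m |\<zeta>\<^sub>m|\<^sup>2\<close> to the derivative of \<open>V\<close>, while the Lipschitz
  nonlinearity contributes \<open>O(\<Sum>\<^sub>m |\<zeta>\<^sub>m|\<^sup>2)\<close> uniformly in \<open>g \<ge> 1\<close>. So for large \<open>g\<close> the errors decay
  exponentially, and input-to-state stability of the agent at \<open>r\<close>, driven by the decaying coupling
  term, yields the claim.
\<close>

section \<open>Eigenvectors modulo an invariant subspace\<close>

text \<open>The vector \<open>p(N) g\<close>, evaluated by Horner's rule along the coefficients of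
  \<open>p\<close>; matrix polynomials themselves are never formed.\<close>

definition poly_act :: "complex poly \<Rightarrow> complex^'n^'n \<Rightarrow> complex^'n \<Rightarrow> complex^'n" where
  "poly_act p N g = fold_coeffs (\<lambda>a v. a *s g + N *v v) p 0"

lemma poly_act_0 [simp]: "poly_act 0 N g = 0"
  by (simp add: poly_act_def)

lemma poly_act_pCons: "poly_act (pCons a p) N g = a *s g + N *v poly_act p N g"
  by (cases "p = 0 \<and> a = 0") (auto simp: poly_act_def)

lemma poly_act_add: "poly_act (p + q) N g = poly_act p N g + poly_act q N g"
proof (induction p arbitrary: q rule: pCons_induct)
  case (pCons a p)
  obtain b q' where q: "q = pCons b q'" by (cases q)
  show ?case
    by (simp add: q poly_act_pCons pCons.IH matrix_vector_right_distrib vector_sadd_rdistrib)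
qed simp

lemma poly_act_smult: "poly_act (smult c p) N g = c *s poly_act p N g"
  by (induction p rule: pCons_induct)
    (simp_all add: poly_act_pCons vector_add_ldistrib vector_smult_assoc vector_scalar_commute)

lemma poly_act_diff: "poly_act (p - q) N g = poly_act p N g - poly_act q N g"
  using poly_act_add[of "p - q" q N g] by simp

lemma poly_act_monom: "poly_act (monom c i) N g = c *s (((*v) N) ^^ i) g"
  by (induction i) (simp_all add: monom_0 monom_Suc poly_act_pCons vector_scalar_commute)

lemma poly_act_sum: "poly_act (\<Sum>i\<in>I. p i) N g = (\<Sum>i\<in>I. poly_act (p i) N g)"
  by (induction I rule: infinite_finite_induct) (simp_all add: poly_act_add)

lemma poly_act_linear_factor:
  "poly_act ([:- l, 1:] * p) N g = N *v poly_act p N g - l *s poly_act p N g"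
  by (simp add: poly_act_diff poly_act_smult poly_act_pCons)

text \<open>The Krylov vectors \<open>g, N g, ..., N^n g\<close> are \<open>n + 1\<close> vectors in
  dimension \<open>n\<close>, hence dependent, and the coefficients of a dependency form the
  polynomial.\<close>

lemma exists_annihilating_poly:
  fixes N :: "complex^'n^'n"
  shows "\<exists>p. p \<noteq> 0 \<and> poly_act p N g = 0"
proof -
  let ?v = "\<lambda>i. (((*v) N) ^^ i) g"
  let ?I = "{..CARD('n)}"
  show ?thesis
  proof (cases "inj_on ?v ?I")
    case True
    have "card (?v ` ?I) = CARD('n) + 1"
      using True by (simp add: card_image)
    moreover have "vec.dim (?v ` ?I) \<le> CARD('n)"
      using vec.dim_subset[of "?v ` ?I" UNIV] unfolding vec_dim_card by simp
    ultimately have "vec.dependent (?v ` ?I)"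
      using vec.independent_bound_general[of "?v ` ?I"] by linarith
    then obtain u where u: "\<exists>x\<in>?v ` ?I. u x \<noteq> 0" "(\<Sum>x\<in>?v ` ?I. u x *s x) = 0"
      by (subst (asm) vec.dependent_finite) auto
    let ?p = "\<Sum>i\<in>?I. monom (u (?v i)) i"
    have "poly_act ?p N g = (\<Sum>i\<in>?I. u (?v i) *s ?v i)"
      by (simp add: poly_act_sum poly_act_monom)
    also have "\<dots> = 0"
      using u(2) sum.reindex[OF True, of "\<lambda>x. u x *s x"] by (simp add: o_def)
    finally have "poly_act ?p N g = 0" .
    moreover obtain j where "j \<in> ?I" "u (?v j) \<noteq> 0"
      using u(1) by auto
    then have "coeff ?p j \<noteq> 0"
      by (simp add: coeff_sum)
    then have "?p \<noteq> 0" by force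
    ultimately show ?thesis by blast
  next
    case False
    \<comment> \<open>If two Krylov vectors coincide, the set of them is too small for the dimension
      count; the coincidence itself gives \<open>X^i - X^j\<close>.\<close>
    then obtain i j where ij: "i \<noteq> j" "?v i = ?v j"
      by (auto simp: inj_on_def)
    let ?p = "monom 1 i + monom (-1) j :: complex poly"
    have "coeff ?p i = 1" using ij by simp
    then have "?p \<noteq> 0" by force
    moreover have "poly_act ?p N g = 0"
      using ij by (simp add: poly_act_add poly_act_monom vector_smult_lneg)
    ultimately show ?thesis by blast
  qed
qed

text \<open>Split \<open>p\<close> into linear factors and apply them to \<open>g\<close> one after
  the other: the iterates start outside \<open>F\<close> and end inside, and the last one outside is
  an eigenvector modulo \<open>F\<close>.\<close>

lemma exists_quotient_eigenvector:
  fixes N :: "complex^'n^'n"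
  assumes F: "vec.subspace F" and "g \<notin> F" "p \<noteq> 0" "poly_act p N g \<in> F"
  shows "\<exists>f l. f \<notin> F \<and> N *v f - l *s f \<in> F"
  using assms(3,4)
proof (induction "degree p" arbitrary: p)
  case 0
  then obtain c where p: "p = [:c:]" "c \<noteq> 0"
    by (metis degree_eq_zeroE pCons_0_0)
  then have "c *s g \<in> F"
    using 0 by (simp add: poly_act_pCons)
  then have "inverse c *s (c *s g) \<in> F"
    by (rule vec.subspace_scale[OF F])
  with p \<open>g \<notin> F\<close> show ?case
    by (simp add: vector_smult_assoc)
next
  case (Suc n)
  then have "\<not> constant (poly p)"
    by (simp add: constant_degree)
  then obtain l where "poly p l = 0"
    using fundamental_theorem_of_algebra by blast
  then obtain q where q: "p = [:- l, 1:] * q"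
    by (metis poly_eq_0_iff_dvd dvdE)
  show ?case
  proof (cases "poly_act q N g \<in> F")
    case True
    have "q \<noteq> 0" using Suc q by auto
    then have "degree p = Suc (degree q)"
      using q by (simp del: mult_pCons_left add: degree_mult_eq)
    then show ?thesis
      using Suc.hyps(1)[of q] \<open>q \<noteq> 0\<close> True Suc.hyps(2) by simp
  next
    case False
    then show ?thesis
      using Suc.prems(2) unfolding q poly_act_linear_factor by blast
  qed
qed

lemma mat_vector_mult: "mat l *v x = l *s (x :: 'a::comm_ring_1^'n)"
  by (simp add: vec_eq_iff matrix_vector_mult_def mat_def if_distrib[of "\<lambda>z. z * _"] cong: if_cong)

text \<open>Were \<open>l I - N\<close> injective, it would map the invariant \<open>F\<close> onto
  itself by dimension, so the image of \<open>f\<close>, which lies in \<open>F\<close>, would have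
  a second preimage inside \<open>F\<close>.\<close>

lemma det_zero_if_shift_into_subspace:
  fixes N :: "complex^'n^'n"
  assumes F: "vec.subspace F" and inv: "\<And>f. f \<in> F \<Longrightarrow> N *v f \<in> F"
    and f: "f \<notin> F" "N *v f - l *s f \<in> F"
  shows "det (mat l - N) = 0"
proof (rule ccontr)
  assume "det (mat l - N) \<noteq> 0"
  then have inj: "inj ((*v) (mat l - N))"
    by (metis invertible_det_nz inj_matrix_vector_mult)
  let ?T = "(*v) (mat l - N)"
  have T: "?T x = l *s x - N *v x" for x
    by (simp add: matrix_vector_mult_diff_rdistrib mat_vector_mult)
  have sub: "?T ` F \<subseteq> F"
    using inv by (auto simp: T intro!: vec.subspace_diff[OF F] vec.subspace_scale[OF F])
  have lin: "Vector_Spaces.linear (*s) (*s) ?T"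
    by (rule matrix_vector_mul_linear_gen)
  have "vec.dim (?T ` F) = vec.dim F"
    by (rule vec.dim_image_eq[OF lin]) (use inj in \<open>auto intro: inj_on_subset\<close>)
  then have "?T ` F = F"
    using vec.subspace_dim_equal[OF vec.subspace_image[OF F] F sub] by simp
  moreover have "?T f \<in> F"
    using vec.subspace_neg[OF F f(2)] by (simp add: T)
  ultimately obtain h where "h \<in> F" "?T h = ?T f"
    by (metis (no_types, lifting) imageE)
  then show False using inj f(1) by (metis injD)
qed

section \<open>Quadratic Lyapunov functions\<close>

text \<open>A complex functional on real vectors, taken without conjugation, so that its real and
  imaginary parts are the real functionals of \<open>Re f\<close> and \<open>Im f\<close>.\<close>

definition cdot :: "complex^'n \<Rightarrow> real^'n \<Rightarrow> complex" where
  "cdot f x = (\<Sum>i\<in>UNIV. f $ i * of_real (x $ i))"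

lemma cdot_add: "cdot (f + h) x = cdot f x + cdot h x"
  by (simp add: cdot_def distrib_right sum.distrib)

lemma cdot_scale: "cdot (c *s f) x = c * cdot f x"
  by (simp add: cdot_def sum_distrib_left mult.assoc)

lemma Re_cdot: "Re (cdot f x) = (\<chi> i. Re (f $ i)) \<bullet> x"
  by (simp add: cdot_def inner_vec_def)

lemma Im_cdot: "Im (cdot f x) = (\<chi> i. Im (f $ i)) \<bullet> x"
  by (simp add: cdot_def inner_vec_def)

lemma cdot_axis: "cdot (axis i 1) x = of_real (x $ i)"
proof -
  have "cdot (axis i 1) x = (\<Sum>j\<in>UNIV. if i = j then of_real (x $ j) else 0)"
    unfolding cdot_def by (rule sum.cong) (auto simp: axis_def)
  then show ?thesis by simp
qed

text \<open>On coefficient vectors of functionals, composition with \<open>M\<close> is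
  multiplication by the transpose; hence the invariant subspaces below are those of the
  transpose.\<close>

lemma cdot_transpose:
  "cdot (transpose (map_matrix complex_of_real M) *v f) x = cdot f (M *v x)"
proof -
  have "cdot (transpose (map_matrix complex_of_real M) *v f) x
      = (\<Sum>i\<in>UNIV. \<Sum>j\<in>UNIV. of_real (M $ j $ i) * f $ j * of_real (x $ i))"
    by (simp add: cdot_def matrix_vector_mult_def transpose_def map_matrix_def sum_distrib_right)
  also have "\<dots> = (\<Sum>j\<in>UNIV. \<Sum>i\<in>UNIV. of_real (M $ j $ i) * f $ j * of_real (x $ i))"
    by (rule sum.swap)
  also have "\<dots> = cdot f (M *v x)"
    by (simp add: cdot_def matrix_vector_mult_def sum_distrib_left mult_ac)
  finally show ?thesis .
qed

text \<open>The sum of the squares of \<open>u m \<bullet> x\<close> decays along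
  \<open>x' = - M x\<close> at least like \<open>exp (- 2 \<mu> t)\<close>. The form may be
  degenerate; it becomes definite only at the end of the construction.\<close>

definition lyapunov_family :: "real^'n^'n \<Rightarrow> real \<Rightarrow> nat \<Rightarrow> (nat \<Rightarrow> real^'n) \<Rightarrow> bool" where
  "lyapunov_family M \<mu> k u \<longleftrightarrow>
     (\<forall>x. \<mu> * (\<Sum>m<k. (u m \<bullet> x)\<^sup>2) \<le> (\<Sum>m<k. (u m \<bullet> x) * (u m \<bullet> (M *v x))))"

text \<open>Equivalently, the real and imaginary parts of \<open>f\<close> lie in the span of the
  \<open>u m\<close>. Once every \<open>f\<close> is controlled, the form is positive
  definite.\<close>

definition family_controls :: "nat \<Rightarrow> (nat \<Rightarrow> real^'n) \<Rightarrow> complex^'n \<Rightarrow> bool" where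
  "family_controls k u f \<longleftrightarrow> (\<exists>c\<ge>0. \<forall>x. (cmod (cdot f x))\<^sup>2 \<le> c * (\<Sum>m<k. (u m \<bullet> x)\<^sup>2))"

text \<open>
  An eigenfunctional \<open>f\<close> modulo \<open>F\<close> is added to the family; weighting the old members by a large
  \<open>K\<close> absorbs the cross term with \<open>h = N f - l f \<in> F\<close>, at the price of half of the gap \<open>\<mu> - \<mu>'\<close>.
\<close>

lemma lyapunov_family_extend:
  fixes M :: "real^'n^'n"
  defines "N \<equiv> transpose (map_matrix complex_of_real M)"
  assumes lyap: "lyapunov_family M ((\<mu> + \<mu>') / 2) k u" and "\<mu>' < \<mu>"
    and F: "\<And>f. f \<in> F \<Longrightarrow> family_controls k u f"
    and f: "N *v f - l *s f \<in> F" "\<mu> \<le> Re l"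
  obtains u' where "lyapunov_family M \<mu>' (k + 2) u'"
    and "\<And>c h. h \<in> F \<Longrightarrow> family_controls (k + 2) u' (c *s f + h)"
proof -
  define h where "h = N *v f - l *s f"
  \<comment> \<open>The old family has rate \<open>\<mu> - d\<close>, the new one only needs
    \<open>\<mu> - 2 * d\<close>; the difference \<open>d\<close> pays for the cross term.\<close>
  define d where "d = (\<mu> - \<mu>') / 2"
  have d: "d > 0" "\<mu>' = \<mu> - 2 * d" "(\<mu> + \<mu>') / 2 = \<mu> - d"
    using \<open>\<mu>' < \<mu>\<close> by (auto simp: d_def field_simps)
  define q where "q x = (\<Sum>m<k. (u m \<bullet> x)\<^sup>2)" for x
  have q0: "0 \<le> q x" for x by (auto simp: q_def intro: sum_nonneg)
  obtain C where C: "C \<ge> 0" "\<And>x. (cmod (cdot h x))\<^sup>2 \<le> C * q x"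
    using F[OF f(1)] by (auto simp: family_controls_def h_def q_def)
  \<comment> \<open>Chosen to give \<open>C / (4 * d) \<le> K * d\<close>, the price of the cross
    term; the summand 1 keeps \<open>K\<close> positive when \<open>C = 0\<close>.\<close>
  define K where "K = C / (4 * d\<^sup>2) + 1"
  have K: "K > 0" "C / (4 * d) \<le> K * d"
    using C d by (auto simp: K_def field_simps power2_eq_square add_nonneg_pos)
  \<comment> \<open>Two real functionals stand for the complex \<open>f\<close>: their squares add
    up to the squared modulus of \<open>cdot f x\<close>.\<close>
  define u' where "u' m = (if m < k then sqrt K *\<^sub>R u m else if m = k then (\<chi> i. Re (f $ i))
    else (\<chi> i. Im (f $ i)))" for m
  have sum': "(\<Sum>m<k + 2. (u' m \<bullet> x) * (u' m \<bullet> y))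
      = K * (\<Sum>m<k. (u m \<bullet> x) * (u m \<bullet> y)) + Re (cnj (cdot f x) * cdot f y)" for x y
  proof -
    have "(\<Sum>m<k. (u' m \<bullet> x) * (u' m \<bullet> y)) = (\<Sum>m<k. K * ((u m \<bullet> x) * (u m \<bullet> y)))"
      using K by (intro sum.cong) (auto simp: u'_def)
    then show ?thesis
      by (simp add: u'_def Re_cdot Im_cdot sum_distrib_left)
  qed
  have q': "(\<Sum>m<k + 2. (u' m \<bullet> x)\<^sup>2) = K * q x + (cmod (cdot f x))\<^sup>2" for x
    using sum'[of x x] by (simp add: q_def power2_eq_square cmod_power2[unfolded power2_eq_square])
  show ?thesis
  proof
    show "lyapunov_family M \<mu>' (k + 2) u'"
      unfolding lyapunov_family_def
    proof
      fix x
      let ?z = "cdot f x" and ?w = "cdot h x"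
      have "N *v f = l *s f + h" by (simp add: h_def)
      then have fM: "cdot f (M *v x) = l * ?z + ?w"
        by (metis N_def cdot_transpose cdot_add cdot_scale)
      have "Re (cnj ?z * ?w) \<ge> - (cmod ?z * cmod ?w)"
        using abs_Re_le_cmod[of "cnj ?z * ?w"] by (simp add: norm_mult)
      moreover have "cmod ?z * cmod ?w \<le> d * (cmod ?z)\<^sup>2 + (cmod ?w)\<^sup>2 / (4 * d)"
      proof -
        \<comment> \<open>Young's inequality after division by \<open>4 * d\<close>: the first part
          is paid from the surplus rate of the new square, the second by the weight \<open>K\<close>
          on the old ones.\<close>
        have "0 \<le> (2 * d * cmod ?z - cmod ?w)\<^sup>2" by simp
        then show ?thesis using d by (simp add: field_simps power2_eq_square)
      qed
      moreover have "(cmod ?w)\<^sup>2 / (4 * d) \<le> K * d * q x"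
      proof -
        have "(cmod ?w)\<^sup>2 / (4 * d) \<le> C * q x / (4 * d)"
          using C(2) d by (intro divide_right_mono) auto
        also have "\<dots> = C / (4 * d) * q x" by simp
        also have "\<dots> \<le> K * d * q x" using K(2) q0 by (intro mult_right_mono) auto
        finally show ?thesis .
      qed
      moreover have "Re (cnj ?z * (l * ?z + ?w)) = Re l * (cmod ?z)\<^sup>2 + Re (cnj ?z * ?w)"
        unfolding cmod_power2 by (simp add: algebra_simps power2_eq_square)
      moreover have "\<mu> * (cmod ?z)\<^sup>2 \<le> Re l * (cmod ?z)\<^sup>2"
        using f(2) by (intro mult_right_mono) auto
      moreover have "K * ((\<mu> - d) * q x) \<le> K * (\<Sum>m<k. (u m \<bullet> x) * (u m \<bullet> (M *v x)))"
        using lyap K unfolding lyapunov_family_def d(3) q_def by (intro mult_left_mono) auto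
      moreover have "0 \<le> d * (cmod ?z)\<^sup>2" using d by simp
      ultimately show "\<mu>' * (\<Sum>m<k + 2. (u' m \<bullet> x)\<^sup>2)
          \<le> (\<Sum>m<k + 2. (u' m \<bullet> x) * (u' m \<bullet> (M *v x)))"
        unfolding q' sum' fM d(2) by (simp add: algebra_simps)
    qed
  next
    fix c h' assume "h' \<in> F"
    then obtain C' where C': "C' \<ge> 0" "\<And>x. (cmod (cdot h' x))\<^sup>2 \<le> C' * q x"
      using F by (auto simp: family_controls_def q_def)
    have "(cmod (cdot (c *s f + h') x))\<^sup>2
        \<le> (2 * (cmod c)\<^sup>2 + 2 * C' / K) * (\<Sum>m<k + 2. (u' m \<bullet> x)\<^sup>2)" for x
    proof -
      let ?a = "cmod c * cmod (cdot f x)" and ?b = "cmod (cdot h' x)"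
      have "cmod (cdot (c *s f + h') x) \<le> ?a + ?b"
        unfolding cdot_add cdot_scale by (metis norm_triangle_ineq norm_mult)
      then have "(cmod (cdot (c *s f + h') x))\<^sup>2 \<le> (?a + ?b)\<^sup>2"
        by (rule power_mono) simp
      also have "\<dots> \<le> 2 * ?a\<^sup>2 + 2 * ?b\<^sup>2"
        using sum_squares_bound[of ?a ?b] by (simp add: power2_sum)
      also have "\<dots> \<le> 2 * (cmod c)\<^sup>2 * (cmod (cdot f x))\<^sup>2 + 2 * (C' * q x)"
        using C'(2)[of x] by (simp add: power_mult_distrib)
      also have "\<dots> \<le> 2 * (cmod c)\<^sup>2 * (K * q x + (cmod (cdot f x))\<^sup>2)
          + 2 * C' / K * (K * q x + (cmod (cdot f x))\<^sup>2)"
        using K C' q0 by (intro add_mono) (auto simp: field_simps)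
      finally show ?thesis unfolding q' by (simp add: algebra_simps)
    qed
    moreover have "0 \<le> 2 * (cmod c)\<^sup>2 + 2 * C' / K" using K C' by auto
    ultimately show "family_controls (k + 2) u' (c *s f + h')"
      unfolding family_controls_def by blast
  qed
qed

text \<open>Triangularization of the transpose of \<open>M\<close>: an invariant space of
  functionals grows by one eigenfunctional at a time until it is everything, and each eigenvalue met
  on the way is one of \<open>M\<close>.\<close>

lemma exists_lyapunov_family:
  fixes M :: "real^'n^'n"
  assumes eig: "\<And>l. det (mat l - map_matrix complex_of_real M) = 0 \<Longrightarrow> \<mu> \<le> Re l"
    and "\<mu>' < \<mu>"
  obtains k u c where "lyapunov_family M \<mu>' k u"
    and "c > 0" "\<And>x. (norm x)\<^sup>2 \<le> c * (\<Sum>m<k. (u m \<bullet> x)\<^sup>2)"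
proof -
  define N where "N = transpose (map_matrix complex_of_real M)"
  \<comment> \<open>All rates below \<open>\<mu>\<close> are demanded at once: each extension
    sacrifices part of the gap, so one fixed rate would not survive the induction.\<close>
  define good where "good F \<longleftrightarrow> vec.subspace F \<and> (\<forall>f\<in>F. N *v f \<in> F) \<and>
    (\<forall>\<mu>'<\<mu>. \<exists>k u. lyapunov_family M \<mu>' k u \<and> (\<forall>f\<in>F. family_controls k u f))" for F
  have step: "\<exists>F'. good F' \<and> vec.dim F < vec.dim F'" if "good F" and proper: "F \<noteq> UNIV" for F
  proof -
    have F: "vec.subspace F" and inv: "\<And>f. f \<in> F \<Longrightarrow> N *v f \<in> F"
      using \<open>good F\<close> by (auto simp: good_def)
    obtain g where "g \<notin> F" using proper by auto
    obtain p where "p \<noteq> 0" "poly_act p N g = 0"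
      using exists_annihilating_poly by blast
    \<comment> \<open>Since \<open>0\<close> lies in \<open>F\<close>, a polynomial annihilating
      \<open>g\<close> sends it into \<open>F\<close>.\<close>
    then obtain f l where f: "f \<notin> F" "N *v f - l *s f \<in> F"
      using exists_quotient_eigenvector[OF F \<open>g \<notin> F\<close>] vec.subspace_0[OF F] by metis
    have "det (mat l - N) = 0"
      by (rule det_zero_if_shift_into_subspace[OF F inv f])
    moreover have "mat l - N = transpose (mat l - map_matrix complex_of_real M)"
      by (simp add: N_def vec_eq_iff transpose_def mat_def eq_commute)
    ultimately have l: "\<mu> \<le> Re l"
      using eig by (metis det_transpose)
    define F' where "F' = {c *s f + h | c h. h \<in> F}"
    have sub': "vec.subspace F'"
      unfolding vec.subspace_def F'_def
    proof (safe, goal_cases)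
      case 1 show ?case
        using vec.subspace_0[OF F] by (intro exI[of _ 0]) auto
    next
      case (2 _ _ c c' h h') then show ?case
        by (intro exI[of _ "c + c'"] exI[of _ "h + h'"])
          (auto simp: vector_sadd_rdistrib vec.subspace_add[OF F])
    next
      case (3 a _ c h) then show ?case
        by (intro exI[of _ "a * c"] exI[of _ "a *s h"])
          (auto simp: vector_add_ldistrib vector_smult_assoc vec.subspace_scale[OF F])
    qed
    have inv': "N *v x \<in> F'" if "x \<in> F'" for x
    proof -
      obtain c h where x: "x = c *s f + h" "h \<in> F" using \<open>x \<in> F'\<close> by (auto simp: F'_def)
      have "N *v x = (c * l) *s f + (c *s (N *v f - l *s f) + N *v h)"
        by (simp add: x(1) matrix_vector_right_distrib vector_scalar_commute vec_eq_iff algebra_simps)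
      moreover have "c *s (N *v f - l *s f) + N *v h \<in> F"
        by (intro vec.subspace_add[OF F] vec.subspace_scale[OF F] f inv x)
      ultimately show ?thesis unfolding F'_def by blast
    qed
    have "\<exists>k u. lyapunov_family M m k u \<and> (\<forall>x\<in>F'. family_controls k u x)" if m: "m < \<mu>" for m
    proof -
      have "(\<mu> + m) / 2 < \<mu>" using m by simp
      then obtain k u where ku: "lyapunov_family M ((\<mu> + m) / 2) k u"
        "\<And>f. f \<in> F \<Longrightarrow> family_controls k u f"
        using \<open>good F\<close> unfolding good_def by blast
      obtain u' where "lyapunov_family M m (k + 2) u'"
        and "\<And>c h. h \<in> F \<Longrightarrow> family_controls (k + 2) u' (c *s f + h)"
        by (rule lyapunov_family_extend[OF ku(1) m ku(2) f(2)[unfolded N_def] l]) simp_all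
      then have "lyapunov_family M m (k + 2) u' \<and> (\<forall>x\<in>F'. family_controls (k + 2) u' x)"
        by (auto simp: F'_def)
      then show ?thesis by blast
    qed
    then have "good F'" using sub' inv' by (auto simp: good_def)
    moreover have "F \<subset> F'"
    proof -
      have "x \<in> F'" if "x \<in> F" for x
        unfolding F'_def mem_Collect_eq using that
        by (intro exI[of _ "0::complex"] exI[of _ x]) simp
      moreover have "f \<in> F'"
        unfolding F'_def mem_Collect_eq using vec.subspace_0[OF F]
        by (intro exI[of _ "1::complex"] exI[of _ "0::complex^'n"]) simp
      ultimately show ?thesis using f(1) by blast
    qed
    then have "vec.dim F < vec.dim F'"
      using F sub' by (intro vec.dim_psubset) (simp add: vec.span_eq_iff[THEN iffD2])
    ultimately show ?thesis by blast
  qed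
  have "\<exists>F. good F \<and> n \<le> vec.dim F" if "n \<le> CARD('n)" for n
    using that
  proof (induction n)
    case 0
    have "lyapunov_family M m 0 (\<lambda>_. 0) \<and> (\<forall>f\<in>{0}. family_controls 0 (\<lambda>_. 0) f)" for m
      by (auto simp: lyapunov_family_def family_controls_def cdot_def)
    then have "good {0}"
      unfolding good_def by (auto simp: vec.subspace_single_0)
    then show ?case by blast
  next
    case (Suc n)
    then obtain F where "good F" "n \<le> vec.dim F" by auto
    show ?case
    proof (cases "F = UNIV")
      case True
      then show ?thesis using \<open>good F\<close> Suc.prems by (metis vec_dim_card)
    next
      case False
      then show ?thesis using step[OF \<open>good F\<close>] \<open>n \<le> vec.dim F\<close> by fastforce
    qed
  qed
  then obtain F where "good F" "CARD('n) \<le> vec.dim F" by blast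
  have "vec.subspace F" using \<open>good F\<close> by (simp add: good_def)
  then have "F = UNIV"
    using vec.subspace_dim_equal[OF _ vec.subspace_UNIV, of F] \<open>CARD('n) \<le> vec.dim F\<close>
    unfolding vec_dim_card by simp
  then obtain k u where ku: "lyapunov_family M \<mu>' k u" "\<And>f. family_controls k u f"
    using \<open>good F\<close> \<open>\<mu>' < \<mu>\<close> unfolding good_def by blast
  \<comment> \<open>In particular the coordinate functionals are controlled; adding up their bounds
    yields definiteness.\<close>
  have "\<forall>i. \<exists>c\<ge>0. \<forall>x. (x $ i)\<^sup>2 \<le> c * (\<Sum>m<k. (u m \<bullet> x)\<^sup>2)"
    using ku(2)[of "axis _ 1"] by (simp add: family_controls_def cdot_axis)
  then obtain c where c: "\<And>i. 0 \<le> c i" "\<And>i x. (x $ i)\<^sup>2 \<le> c i * (\<Sum>m<k. (u m \<bullet> x)\<^sup>2)"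
    by metis
  have "(norm x)\<^sup>2 \<le> (sum c UNIV + 1) * (\<Sum>m<k. (u m \<bullet> x)\<^sup>2)" for x
  proof -
    have "(norm x)\<^sup>2 = (\<Sum>i\<in>UNIV. (x $ i)\<^sup>2)"
      by (simp add: norm_vec_def L2_set_def sum_nonneg)
    also have "\<dots> \<le> sum c UNIV * (\<Sum>m<k. (u m \<bullet> x)\<^sup>2)"
      unfolding sum_distrib_right by (intro sum_mono c)
    also have "\<dots> \<le> (sum c UNIV + 1) * (\<Sum>m<k. (u m \<bullet> x)\<^sup>2)"
      by (intro mult_right_mono sum_nonneg) auto
    finally show ?thesis .
  qed
  moreover have "sum c UNIV + 1 > 0"
    using c(1) by (simp add: sum_nonneg add_nonneg_pos)
  ultimately show ?thesis using that ku(1) by blast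
qed

section \<open>The spectrum of the Laplacian\<close>

lemma poly_det: "poly (det M) z = det (map_matrix (\<lambda>p. poly p z) M)"
  by (simp add: det_def poly_sum poly_prod map_matrix_def)

lemma poly_charpoly: "poly (charpoly M) z = det (mat z - M)"
proof -
  have "map_matrix (\<lambda>p. poly p z) (mat [:0, 1:] - map_matrix (\<lambda>c. [:c:]) M) = mat z - M"
    by (simp add: vec_eq_iff map_matrix_def mat_def)
  then show ?thesis by (simp add: charpoly_def poly_det)
qed

lemma det_eq_0_iff_eigenvector:
  fixes M :: "complex^'n^'n"
  shows "det (mat l - M) = 0 \<longleftrightarrow> (\<exists>x. x \<noteq> 0 \<and> M *v x = l *s x)"
proof -
  have "det (mat l - M) \<noteq> 0 \<longleftrightarrow> (\<exists>B. B ** (mat l - M) = mat 1)"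
    by (simp add: invertible_det_nz[symmetric] invertible_left_inverse)
  also have "\<dots> \<longleftrightarrow> (\<forall>x. (mat l - M) *v x = 0 \<longrightarrow> x = 0)"
    by (rule matrix_left_invertible_ker)
  finally show ?thesis
    by (auto simp: matrix_vector_mult_diff_rdistrib mat_vector_mult)
qed

lemma norm_vector_smult: "norm (z *s x) = cmod z * norm x"
  by (simp add: norm_vec_def norm_mult L2_set_right_distrib)

text \<open>Otherwise every number would be an eigenvalue, even one beyond the operator bound of
  \<open>M\<close>. Nonvanishing is what makes the root multiset contain every root.\<close>

lemma charpoly_nonzero: "charpoly M \<noteq> (0 :: complex poly)"
proof
  assume "charpoly M = 0"
  then have det: "det (mat z - M) = 0" for z
    by (metis poly_charpoly poly_0)
  have "bounded_linear ((*v) M)" by (rule matrix_vector_mul_bounded_linear)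
  then obtain b where b: "b > 0" "\<And>x. norm (M *v x) \<le> norm x * b"
    using bounded_linear.pos_bounded by blast
  obtain x where x: "x \<noteq> 0" "M *v x = of_real (b + 1) *s x"
    using det[of "of_real (b + 1)"] unfolding det_eq_0_iff_eigenvector by blast
  have "norm (of_real (b + 1) *s x) = (b + 1) * norm x"
    using b(1) by (simp only: norm_vector_smult norm_of_real)
  then show False
    using b(2)[of x] x by (simp add: algebra_simps)
qed

lemma laplacian_eigenvalue_in_other_eigenvalues:
  assumes "map_matrix complex_of_real (laplacian A) *v x = l *s x" "x \<noteq> 0" "l \<noteq> 0"
  shows "l \<in># other_eigenvalues A"
proof -
  have "poly (charpoly (map_matrix complex_of_real (laplacian A))) l = 0"
    using assms by (auto simp: poly_charpoly det_eq_0_iff_eigenvector)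
  then have "l \<in># eigenvalues (laplacian A)"
    by (simp add: eigenvalues_def charpoly_nonzero)
  then show ?thesis
    using \<open>l \<noteq> 0\<close> by (simp add: other_eigenvalues_def in_diff_count)
qed

section \<open>Maximum principle for the Laplacian\<close>

lemma laplacian_mult:
  assumes "comm_graph E A"
  shows "(laplacian A *v x) $ k = (\<Sum>j\<in>UNIV. A $ k $ j * (x $ k - x $ j))"
proof -
  \<comment> \<open>Without self-loops the subtracted term vanishes at \<open>j = k\<close>, so
    diagonal and off-diagonal entries fit one formula.\<close>
  have "A $ k $ k = 0" using assms unfolding comm_graph_def by blast
  then have "laplacian A $ k $ j * x $ j = (if j = k then (\<Sum>i\<in>UNIV. A $ k $ i) * x $ k else 0)
      - A $ k $ j * x $ j" for j
    by (auto simp: laplacian_def)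
  then show ?thesis
    by (simp add: matrix_vector_mult_def sum_subtractf right_diff_distrib sum_distrib_right)
qed

text \<open>At a maximal node the Laplacian row is a vanishing sum of nonnegative terms, so every
  node that feeds it is maximal too. Iteration along the path reaches its start.\<close>

lemma max_propagates_along_path:
  fixes x :: "real^'n"
  assumes "comm_graph E A" "path_from_to E v k ls"
    and harmonic: "laplacian A *v x = 0" and max: "\<And>j. x $ j \<le> x $ k"
  shows "x $ v = x $ k"
proof -
  have nbr: "x $ j = x $ i" if "(i, j) \<in> E" "x $ i = x $ k" for i j
  proof -
    have "(\<Sum>j\<in>UNIV. A $ i $ j * (x $ i - x $ j)) = 0"
      using laplacian_mult[OF assms(1), of x i] harmonic by simp
    moreover have "0 \<le> A $ i $ j * (x $ i - x $ j)" for j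
      using assms(1) max[of j] that(2) by (auto simp: comm_graph_def)
    ultimately have "A $ i $ j * (x $ i - x $ j) = 0"
      by (subst (asm) sum_nonneg_eq_0_iff) auto
    then show ?thesis using assms(1) that(1) by (auto simp: comm_graph_def)
  qed
  have ls: "ls \<noteq> []" "ls ! 0 = v" "ls ! (length ls - 1) = k"
    "\<And>i. Suc i < length ls \<Longrightarrow> (ls ! Suc i, ls ! i) \<in> E"
    using assms(2) by (auto simp: path_from_to_def hd_conv_nth last_conv_nth)
  \<comment> \<open>The induction runs backwards from the last node, where the maximum is
    known.\<close>
  have "x $ (ls ! (length ls - 1 - i)) = x $ k" if "i \<le> length ls - 1" for i
    using that
  proof (induction i)
    case 0
    show ?case using ls(3) by simp
  next
    case (Suc i)
    then have "Suc (length ls - 1 - Suc i) = length ls - 1 - i" by simp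
    then show ?case
      using Suc ls(4)[of "length ls - 1 - Suc i"] nbr by (metis Suc_leD diff_less length_greater_0_conv ls(1)
          less_one order_le_less_trans diff_le_self)
  qed
  from this[of "length ls - 1"] ls show ?thesis by simp
qed

text \<open>The root of the graph attains the maximum of every kernel vector. Applied to
  \<open>x\<close> and \<open>- x\<close>, its value is both maximum and minimum.\<close>

lemma laplacian_kernel_constant:
  fixes x :: "real^'n"
  assumes "comm_graph E A" "graph_connected E" and harmonic: "laplacian A *v x = 0"
  obtains b where "\<And>j. x $ j = b"
proof -
  obtain v where v: "\<And>k. k \<noteq> v \<Longrightarrow> \<exists>ls. path_from_to E v k ls"
    using assms(2) by (auto simp: graph_connected_def)
  have le: "y $ j \<le> y $ v" if y: "laplacian A *v y = 0" for y :: "real^'n" and j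
  proof -
    have "Max (range (($) y)) \<in> range (($) y)" by (rule Max_in) auto
    then obtain k where k: "y $ k = Max (range (($) y))" by (metis imageE)
    then have max: "y $ j \<le> y $ k" for j by simp
    have "y $ v = y $ k"
      using v[of k] max_propagates_along_path[OF assms(1) _ y max] by (cases "k = v") auto
    then show ?thesis using max by simp
  qed
  have "laplacian A *v (- x) = 0"
    using harmonic by (metis add.inverse_neutral vec.neg)
  from le[OF this] le[OF harmonic] have "x $ j = x $ v" for j
    by (force intro: antisym)
  then show ?thesis by (rule that)
qed

text \<open>At a maximal node the Laplacian is nonnegative; this is applied to \<open>x\<close> and
  \<open>- x\<close>. It excludes a Jordan chain for the eigenvalue 0 above the all-ones
  vector.\<close>

lemma laplacian_constant_image_zero:
  fixes x :: "real^'n"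
  assumes "comm_graph E A" and const: "\<And>k. (laplacian A *v x) $ k = c"
  shows "c = 0"
proof -
  have ge: "0 \<le> b" if "\<And>k. (laplacian A *v y) $ k = b" for y :: "real^'n" and b
  proof -
    have "Max (range (($) y)) \<in> range (($) y)" by (rule Max_in) auto
    then obtain k where k: "y $ k = Max (range (($) y))" by (metis imageE)
    then have "0 \<le> A $ k $ j * (y $ k - y $ j)" for j
      using assms(1) by (auto simp: comm_graph_def)
    then have "0 \<le> (\<Sum>j\<in>UNIV. A $ k $ j * (y $ k - y $ j))"
      by (rule sum_nonneg)
    then show ?thesis
      using that[of k] laplacian_mult[OF assms(1), of y k] by simp
  qed
  have "(laplacian A *v (- x)) $ k = - c" for k
    using const[of k] by (simp add: vec.neg)
  from ge[OF this] ge[OF const] show ?thesis by simp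
qed

section \<open>Complex vectors through their real and imaginary parts\<close>

lemma Re_laplacian:
  "(\<chi> k. Re ((map_matrix complex_of_real L *v x) $ k)) = L *v (\<chi> k. Re (x $ k))"
  by (simp add: vec_eq_iff matrix_vector_mult_def map_matrix_def)

lemma Im_laplacian:
  "(\<chi> k. Im ((map_matrix complex_of_real L *v x) $ k)) = L *v (\<chi> k. Im (x $ k))"
  by (simp add: vec_eq_iff matrix_vector_mult_def map_matrix_def)

lemma complex_laplacian_constant_image:
  fixes x :: "complex^'n"
  assumes "comm_graph E A" "graph_connected E"
    and const: "\<And>k. (map_matrix complex_of_real (laplacian A) *v x) $ k = c"
  obtains b where "\<And>j. x $ j = b"
proof -
  have re: "laplacian A *v (\<chi> k. Re (x $ k)) = (\<chi> k. Re c)"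
    and im: "laplacian A *v (\<chi> k. Im (x $ k)) = (\<chi> k. Im c)"
    using const by (simp_all flip: Re_laplacian Im_laplacian)
  have "Re c = 0" "Im c = 0"
    using laplacian_constant_image_zero[OF assms(1), of "\<chi> k. Re (x $ k)"]
      laplacian_constant_image_zero[OF assms(1), of "\<chi> k. Im (x $ k)"] by (simp_all add: re im)
  then have "laplacian A *v (\<chi> k. Re (x $ k)) = 0" "laplacian A *v (\<chi> k. Im (x $ k)) = 0"
    by (simp_all add: re im vec_eq_iff)
  then obtain b b' where "\<And>j. Re (x $ j) = b" "\<And>j. Im (x $ j) = b'"
    using laplacian_kernel_constant[OF assms(1,2)] by (metis vec_lambda_beta)
  then have "x $ j = Complex b b'" for j by (simp add: complex_eq_iff)
  then show ?thesis by (rule that)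
qed

text \<open>Subtracting row \<open>r\<close> from all rows realizes the quotient by the constant
  vectors on the hyperplane \<open>x $ r = 0\<close>; the entry \<open>c\<close> in column
  \<open>r\<close> turns the eigenvalue 0 of the all-ones vector into \<open>c\<close>.\<close>

definition deflated :: "real^'n^'n \<Rightarrow> 'n \<Rightarrow> real \<Rightarrow> real^'n^('n::finite)" where
  "deflated A r c =
     (\<chi> k j. laplacian A $ k $ j - laplacian A $ r $ j + (if j = r then c else 0))"

lemma deflated_mult:
  "(deflated A r c *v x) $ k = (laplacian A *v x) $ k - (laplacian A *v x) $ r + c * x $ r"
proof -
  have "deflated A r c $ k $ j * x $ j = laplacian A $ k $ j * x $ j - laplacian A $ r $ j * x $ j
      + (if j = r then c * x $ r else 0)" for j
    by (simp add: deflated_def algebra_simps)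
  then show ?thesis
    by (simp add: matrix_vector_mult_def sum.distrib sum_subtractf)
qed

lemma complex_deflated_mult:
  "(map_matrix complex_of_real (deflated A r c) *v x) $ k =
     (map_matrix complex_of_real (laplacian A) *v x) $ k
     - (map_matrix complex_of_real (laplacian A) *v x) $ r + c * x $ r"
  by (simp add: complex_eq_iff vec_lambda_beta deflated_mult
      Re_laplacian[THEN vec_eq_iff[THEN iffD1], THEN spec, unfolded vec_lambda_beta]
      Im_laplacian[THEN vec_eq_iff[THEN iffD1], THEN spec, unfolded vec_lambda_beta])

lemma laplacian_mult_one:
  "map_matrix complex_of_real (laplacian A) *v (\<chi> k. b) = 0" if "comm_graph E A"
proof -
  have "laplacian A *v (\<chi> k. b) = 0" for b
    by (simp add: vec_eq_iff laplacian_mult[OF that])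
  then show ?thesis
    using Re_laplacian[of "laplacian A" "\<chi> k. b"] Im_laplacian[of "laplacian A" "\<chi> k. b"]
    by (simp add: vec_eq_iff complex_eq_iff)
qed

text \<open>
  An eigenvector \<open>x\<close> with \<open>x\<^sub>r = 0\<close> satisfies \<open>L x = l x + c 1\<close>. The maximum principle excludes
  \<open>l = 0\<close>, and for \<open>l \<noteq> 0\<close> the shifted vector \<open>x + (c / l) 1\<close> is an eigenvector of \<open>L\<close>.
\<close>

lemma deflated_eigenvalue_bound:
  assumes G: "comm_graph E A" "graph_connected E"
    and mu: "\<forall>z\<in>#other_eigenvalues A. Re z \<ge> \<mu>"
    and det: "det (mat l - map_matrix complex_of_real (deflated A r \<mu>)) = 0"
  shows "\<mu> \<le> Re l"
proof -
  let ?L = "map_matrix complex_of_real (laplacian A)"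
  obtain x where x: "x \<noteq> 0" "map_matrix complex_of_real (deflated A r \<mu>) *v x = l *s x"
    using det unfolding det_eq_0_iff_eigenvector by blast
  have eq: "(?L *v x) $ k - (?L *v x) $ r + \<mu> * x $ r = l * x $ k" for k
    using complex_deflated_mult[where A = A and r = r and c = \<mu> and x = x and k = k] x(2) by simp
  show ?thesis
  proof (cases "x $ r = 0")
    case False
    then have "l = \<mu>" using eq[of r] by simp
    then show ?thesis by simp
  next
    case True
    define c where "c = (?L *v x) $ r"
    have Lx: "(?L *v x) $ k = l * x $ k + c" for k
      using eq[of k] True by (simp add: c_def algebra_simps)
    have not_const: "\<not> (\<forall>j. x $ j = b)" for b
    proof
      assume b: "\<forall>j. x $ j = b"
      with True have "b = 0" by auto
      with b x(1) show False by (auto simp: vec_eq_iff)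
    qed
    have "l \<noteq> 0"
    proof
      assume "l = 0"
      then have "(?L *v x) $ k = c" for k using Lx by simp
      then obtain b where "\<And>j. x $ j = b"
        by (rule complex_laplacian_constant_image[OF G]) blast
      then show False using not_const by blast
    qed
    let ?y = "x + (\<chi> k. c / l)"
    have "?L *v ?y = l *s ?y"
      using \<open>l \<noteq> 0\<close> by (simp add: vec_eq_iff matrix_vector_right_distrib laplacian_mult_one[OF G(1)]
          Lx distrib_left)
    moreover have "?y \<noteq> 0"
      using not_const[of "- (c / l)"] by (auto simp: vec_eq_iff eq_neg_iff_add_eq_0)
    ultimately show ?thesis
      using laplacian_eigenvalue_in_other_eigenvalues \<open>l \<noteq> 0\<close> mu by blast
  qed
qed

section \<open>Global existence for Lipschitz vector fields\<close>

lemma integral_has_vector_derivative_half_line: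
  fixes h :: "real \<Rightarrow> 'a::banach"
  assumes "continuous_on UNIV h" "0 \<le> t"
  shows "((\<lambda>s. integral {0..s} h) has_vector_derivative h t) (at t within {0..})"
proof -
  have "((\<lambda>s. integral {0..s} h) has_vector_derivative h t) (at t within {0..t + 1})"
    using assms by (intro integral_has_vector_derivative continuous_on_subset[OF assms(1)]) auto
  moreover have "at t within {0..t + 1} = at t within {0..}"
    by (rule at_within_nhd[of _ "{..<t + 1}"]) auto
  ultimately show ?thesis by simp
qed

text \<open>Integrating growth \<open>exp (c * t)\<close> gains a factor \<open>1 / c\<close>; in
  the weighted norm this makes the Picard operator contract for large \<open>c\<close>.\<close>

lemma norm_integral_le_exp:
  fixes h :: "real \<Rightarrow> 'a::banach"
  assumes "continuous_on UNIV h" "0 \<le> s" "c > 0" "0 \<le> b"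
    and le: "\<And>\<sigma>. 0 \<le> \<sigma> \<Longrightarrow> norm (h \<sigma>) \<le> b * exp (c * \<sigma>)"
  shows "exp (- (c * s)) * norm (integral {0..s} h) \<le> b / c"
proof -
  have I: "((\<lambda>\<sigma>. b * exp (c * \<sigma>)) has_integral (b / c * exp (c * s) - b / c * exp (c * 0))) {0..s}"
    using assms(2,3) by (intro fundamental_theorem_of_calculus)
      (auto intro!: derivative_eq_intros simp flip: has_real_derivative_iff_has_vector_derivative)
  have "norm (integral {0..s} h) \<le> integral {0..s} (\<lambda>\<sigma>. b * exp (c * \<sigma>))"
    using I le by (intro integral_norm_bound_integral integrable_continuous_real
        continuous_on_subset[OF assms(1)] continuous_intros) auto
  also have "\<dots> \<le> b / c * exp (c * s)"
    using integral_unique[OF I] assms by simp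
  finally have "exp (- (c * s)) * norm (integral {0..s} h) \<le> exp (- (c * s)) * (b / c * exp (c * s))"
    by (rule mult_left_mono) simp
  then show ?thesis by (simp add: exp_minus field_simps)
qed

text \<open>
  With \<open>x t = exp (c t) y t\<close> the Picard operator becomes a contraction on the bounded continuous
  functions \<open>y\<close> on the whole half line; \<open>max 0\<close> extends them to all of \<open>\<real>\<close>.
\<close>

theorem lipschitz_exists_free_solution:
  fixes f :: "'a::banach \<Rightarrow> 'a"
  assumes "L-lipschitz_on UNIV f"
  shows "\<exists>x. is_free_solution f x0 x"
proof -
  have L: "0 \<le> L" "\<And>x y. dist (f x) (f y) \<le> L * dist x y"
    using assms by (auto simp: lipschitz_on_def)
  have cont_f: "continuous_on UNIV f"
    using assms by (rule lipschitz_on_continuous_on)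
  \<comment> \<open>The contraction factor \<open>L / c\<close> stays below 1, and \<open>c\<close>
    is positive even for \<open>L = 0\<close>.\<close>
  define c where "c = 2 * L + 1"
  have c: "c > 0" "L / c < 1" using L by (auto simp: c_def field_simps)
  define h where "h y \<sigma> = f (exp (c * \<sigma>) *\<^sub>R apply_bcontfun y \<sigma>)" for y \<sigma>
  have cont_h: "continuous_on UNIV (h y)" for y
    unfolding h_def
    by (intro continuous_on_compose2[OF cont_f] continuous_intros) auto
  define T where "T y t = exp (- (c * max 0 t)) *\<^sub>R (x0 + integral {0..max 0 t} (h y))" for y t
  have cont_T: "continuous_on UNIV (T y)" for y
  proof -
    have "continuous_on {0..} (\<lambda>s. integral {0..s} (h y))"
      using integral_has_vector_derivative_half_line[OF cont_h]
      by (intro continuous_on_vector_derivative) auto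
    then have "continuous_on UNIV (\<lambda>t. integral {0..max 0 t} (h y))"
      by (rule continuous_on_compose2) (auto intro!: continuous_intros)
    then show ?thesis
      unfolding T_def by (intro continuous_intros)
  qed
  have bounded_T: "bounded (range (T y))" for y
  proof -
    have "norm (h y \<sigma>) \<le> (norm (f 0) + L * norm y) * exp (c * \<sigma>)" if "0 \<le> \<sigma>" for \<sigma>
    proof -
      have "norm (h y \<sigma>) \<le> norm (f 0) + dist (h y \<sigma>) (f 0)"
        by (metis dist_norm norm_triangle_sub)
      also have "dist (h y \<sigma>) (f 0) \<le> L * (exp (c * \<sigma>) * norm (apply_bcontfun y \<sigma>))"
        using L(2)[of "exp (c * \<sigma>) *\<^sub>R apply_bcontfun y \<sigma>" 0] by (simp add: h_def)
      also have "\<dots> \<le> L * (exp (c * \<sigma>) * norm y)"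
        by (intro mult_left_mono norm_bounded L) auto
      also have "norm (f 0) \<le> norm (f 0) * exp (c * \<sigma>)"
        using c(1) that by (simp add: mult_le_cancel_left1)
      finally show ?thesis by (simp add: algebra_simps)
    qed
    then have I: "exp (- (c * s)) * norm (integral {0..s} (h y)) \<le> (norm (f 0) + L * norm y) / c"
      if "0 \<le> s" for s
      using that c(1) L(1) by (intro norm_integral_le_exp[OF cont_h]) auto
    have "norm (T y t) \<le> norm x0 + (norm (f 0) + L * norm y) / c" for t
    proof -
      have "norm (T y t) \<le> exp (- (c * max 0 t)) * norm x0
          + exp (- (c * max 0 t)) * norm (integral {0..max 0 t} (h y))"
        unfolding T_def by (simp add: norm_triangle_ineq flip: distrib_left)
      also have "exp (- (c * max 0 t)) * norm x0 \<le> 1 * norm x0"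
        using c(1) by (intro mult_right_mono) auto
      finally show ?thesis using I[of "max 0 t"] by simp
    qed
    then show ?thesis by (intro boundedI) auto
  qed
  have T: "T y \<in> bcontfun" for y
    using cont_T bounded_T by (simp add: bcontfun_def)
  have "dist (Bcontfun (T y)) (Bcontfun (T z)) \<le> L / c * dist y z" for y z
  proof (rule dist_bound)
    fix t :: real
    let ?s = "max 0 t"
    have "norm (h y \<sigma> - h z \<sigma>) \<le> L * dist y z * exp (c * \<sigma>)" for \<sigma>
    proof -
      have "norm (h y \<sigma> - h z \<sigma>)
          \<le> L * dist (exp (c * \<sigma>) *\<^sub>R apply_bcontfun y \<sigma>) (exp (c * \<sigma>) *\<^sub>R apply_bcontfun z \<sigma>)"
        using L(2) by (simp add: h_def flip: dist_norm)
      also have "\<dots> = L * (exp (c * \<sigma>) * dist (apply_bcontfun y \<sigma>) (apply_bcontfun z \<sigma>))"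
        by (simp add: dist_norm flip: scaleR_right_diff_distrib)
      also have "\<dots> \<le> L * (exp (c * \<sigma>) * dist y z)"
        by (intro mult_left_mono dist_bounded L) auto
      finally show ?thesis by (simp add: mult_ac)
    qed
    then have "exp (- (c * ?s)) * norm (integral {0..?s} (\<lambda>\<sigma>. h y \<sigma> - h z \<sigma>)) \<le> L * dist y z / c"
      using c(1) L(1) by (intro norm_integral_le_exp continuous_intros cont_h) auto
    moreover have "integral {0..?s} (\<lambda>\<sigma>. h y \<sigma> - h z \<sigma>)
        = integral {0..?s} (h y) - integral {0..?s} (h z)"
      by (intro Henstock_Kurzweil_Integration.integral_diff integrable_continuous_real
          continuous_on_subset[OF cont_h]) auto
    moreover have "T y t - T z t
        = exp (- (c * ?s)) *\<^sub>R (integral {0..?s} (h y) - integral {0..?s} (h z))"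
      by (simp add: T_def algebra_simps)
    ultimately show "dist (apply_bcontfun (Bcontfun (T y)) t) (apply_bcontfun (Bcontfun (T z)) t)
        \<le> L / c * dist y z"
      by (simp add: Bcontfun_inverse T dist_norm)
  qed
  then have "\<exists>!y. Bcontfun (T y) = y"
    using c L(1) by (intro banach_fix_type[of "L / c"]) auto
  then obtain y where "Bcontfun (T y) = y" by blast
  then have y: "apply_bcontfun y t = T y t" for t
    by (metis Bcontfun_inverse T)
  define x where "x t = exp (c * t) *\<^sub>R apply_bcontfun y t" for t
  have x: "x t = x0 + integral {0..t} (h y)" if "0 \<le> t" for t
    using that by (simp add: x_def y T_def exp_minus)
  have "(x has_vector_derivative f (x t)) (at t within {0..})" if "0 \<le> t" for t
  proof -
    have "((\<lambda>s. x0 + integral {0..s} (h y)) has_vector_derivative 0 + h y t) (at t within {0..})"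
      by (intro has_vector_derivative_add has_vector_derivative_const
          integral_has_vector_derivative_half_line cont_h that)
    then have "(x has_vector_derivative 0 + h y t) (at t within {0..})"
      by (rule has_vector_derivative_transform[rotated 2]) (use that x in auto)
    then show ?thesis by (simp add: h_def x_def)
  qed
  moreover from this have "continuous_on {0..} x"
    by (intro continuous_on_vector_derivative) auto
  moreover have "x 0 = x0" using x[of 0] by simp
  ultimately show ?thesis by (auto simp: is_solution_def)
qed

section \<open>Decay of the synchronization error\<close>

text \<open>Gronwall's argument: the derivative of \<open>exp t * V t\<close> is
  nonpositive.\<close>

lemma exp_decay:
  fixes V :: "real \<Rightarrow> real"
  assumes deriv: "\<And>t. 0 \<le> t \<Longrightarrow> (V has_real_derivative V' t) (at t within {0..})"
    and le: "\<And>t. 0 \<le> t \<Longrightarrow> V' t \<le> - V t" and "0 \<le> t"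
  shows "V t \<le> V 0 * exp (- t)"
proof -
  define f where "f s = exp s * V s" for s
  have f: "(f has_real_derivative exp s * V' s + exp s * V s) (at s within {0..})" if "0 \<le> s" for s
    unfolding f_def using deriv[OF that] by (auto intro!: derivative_eq_intros)
  have "f t \<le> f 0"
  proof (rule DERIV_nonpos_imp_decreasing_open[OF \<open>0 \<le> t\<close>])
    fix s :: real assume "0 < s" "s < t"
    then have "at s within {0..} = at s"
      by (intro at_within_interior) simp
    moreover have "exp s * V' s + exp s * V s \<le> 0"
      using le[of s] \<open>0 < s\<close> by (simp flip: distrib_left add: mult_nonneg_nonpos)
    ultimately show "\<exists>y. (f has_real_derivative y) (at s) \<and> y \<le> 0"
      using f[of s] \<open>0 < s\<close> by auto
  next
    show "continuous_on {0..t} f"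
      by (rule DERIV_continuous_on[OF DERIV_subset[OF f]]) auto
  qed
  then have "exp (- t) * f t \<le> exp (- t) * f 0" by simp
  then show ?thesis by (simp add: f_def exp_minus field_simps)
qed

section \<open>Prime form in vector notation and the high-gain scaling\<close>

definition c_vec :: "real^('d::{finite,linorder})" where
  "c_vec = (\<chi> i. if pos i = 1 then 1 else 0)"

definition b_vec :: "real^('d::{finite,linorder})" where
  "b_vec = (\<chi> i. if pos i = CARD('d) then 1 else 0)"

lemma C_mat_mult: "C_mat *v x = vec (c_vec \<bullet> x)"
  by (simp add: vec_eq_iff matrix_vector_mult_def C_mat_def c_vec_def inner_vec_def)

lemma transpose_C_mat_mult: "transpose C_mat *v s = (s $ 1) *\<^sub>R c_vec"
  by (simp add: vec_eq_iff matrix_vector_mult_def C_mat_def c_vec_def transpose_def)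

lemma agent_field_eq: "agent_field \<phi> w = S_mat *v w + \<phi> w *\<^sub>R b_vec"
  by (simp add: agent_field_def vec_eq_iff matrix_vector_mult_def B_mat_def b_vec_def)

text \<open>The coupling sum of the scalar outputs is minus a row of the Laplacian, so the graph
  enters only through \<open>laplacian A\<close>.\<close>

lemma network_field_component:
  assumes "comm_graph E A"
  shows "network_field \<phi> A (P ** transpose C_mat) g w $ k =
    agent_field \<phi> (w $ k)
      - ((laplacian A *v (\<chi> j. c_vec \<bullet> w $ j)) $ k) *\<^sub>R (D_mat g *v (P *v c_vec))"
proof -
  let ?s = "\<Sum>j\<in>UNIV. A $ k $ j *\<^sub>R (C_mat *v (w $ j) - C_mat *v (w $ k))"
  have "?s $ 1 = - ((laplacian A *v (\<chi> j. c_vec \<bullet> w $ j)) $ k)"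
    by (simp add: laplacian_mult[OF assms] C_mat_mult algebra_simps sum_subtractf)
  moreover have "(D_mat g ** (P ** transpose C_mat)) *v ?s = (?s $ 1) *\<^sub>R (D_mat g *v (P *v c_vec))"
    by (simp only: matrix_vector_mul_assoc[symmetric] transpose_C_mat_mult matrix_vector_mult_scaleR)
  ultimately show ?thesis by (simp add: network_field_def)
qed

definition scale :: "real \<Rightarrow> real^('d::{finite,linorder}) \<Rightarrow> real^('d::{finite,linorder})" where
  "scale g x = (\<chi> i. x $ i / g ^ pos i)"

lemma linear_scale: "linear (scale g)"
  by (rule linearI) (simp_all add: scale_def vec_eq_iff add_divide_distrib)

lemma scale_D_mat: "g > 0 \<Longrightarrow> scale g (D_mat g *v x) = x"
  by (simp add: scale_def D_mat_def vec_eq_iff matrix_vector_mult_def if_distrib[of "\<lambda>z. z * _"]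
      cong: if_cong)

text \<open>A nonzero entry of \<open>S_mat\<close> links consecutive positions, whose scalings
  differ by one factor \<open>g\<close>; this puts the high gain in front of the linear
  part.\<close>

lemma scale_S_mat:
  assumes "g > 0"
  shows "scale g (S_mat *v x) = g *\<^sub>R (S_mat *v scale g x)"
proof -
  have "S_mat $ i $ j * x $ j / g ^ pos i = g * (S_mat $ i $ j * (x $ j / g ^ pos j))" for i j
    using assms by (simp add: S_mat_def)
  then show ?thesis
    by (simp add: scale_def vec_eq_iff matrix_vector_mult_def sum_divide_distrib sum_distrib_left)
qed

lemma scale_b_vec: "scale g (b_vec :: real^'d::{finite,linorder}) = (1 / g ^ CARD('d)) *\<^sub>R b_vec"
  by (simp add: scale_def b_vec_def vec_eq_iff)

lemma c_vec_scale:
  assumes "g > 0"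
  shows "c_vec \<bullet> x = g * (c_vec \<bullet> scale g x)"
  using assms unfolding inner_vec_def sum_distrib_left
  by (intro sum.cong) (auto simp: c_vec_def scale_def)

text \<open>Undoing the scaling costs at most \<open>g ^ CARD('d)\<close>, just what
  \<open>scale_b_vec\<close> gains; so the Lipschitz term stays bounded uniformly in
  \<open>g\<close>.\<close>

lemma norm_le_norm_scale:
  fixes x :: "real^'d::{finite,linorder}"
  assumes "g \<ge> 1"
  shows "norm x \<le> g ^ CARD('d) * norm (scale g x)"
proof -
  have "norm (x $ i) \<le> norm ((g ^ CARD('d) *\<^sub>R scale g x) $ i)" for i
  proof -
    have "g ^ pos i \<le> g ^ CARD('d)"
      using assms by (intro power_increasing) (auto simp: pos_def intro: card_mono)
    then have "1 * \<bar>x $ i\<bar> \<le> g ^ CARD('d) / g ^ pos i * \<bar>x $ i\<bar>"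
      using assms by (intro mult_right_mono) auto
    moreover have "norm ((g ^ CARD('d) *\<^sub>R scale g x) $ i) = g ^ CARD('d) / g ^ pos i * \<bar>x $ i\<bar>"
      using assms by (simp only: scale_def vector_scaleR_component vec_lambda_beta real_norm_def
          abs_mult abs_divide power_abs real_scaleR_def) simp
    ultimately show ?thesis by simp
  qed
  then have "norm x \<le> norm (g ^ CARD('d) *\<^sub>R scale g x)"
    by (rule norm_le_componentwise_cart)
  then show ?thesis using assms by simp
qed

section \<open>Positive definite matrices and the Riccati equation\<close>

lemma pos_def_symmetric_bounds:
  fixes P :: "real^'d^'d"
  assumes "pos_def_symmetric P"
  obtains p q where "p > 0" "\<And>x. p * (norm x)\<^sup>2 \<le> x \<bullet> (P *v x)"
    and "q > 0" "\<And>x. norm (P *v x) \<le> q * norm x"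
proof -
  obtain q where q: "q > 0" "\<And>x. norm (P *v x) \<le> q * norm x"
    using linear_bounded_pos[OF matrix_vector_mul_linear[of P]] by blast
  have cont: "continuous_on (sphere 0 1) (\<lambda>x. x \<bullet> (P *v x))"
    by (intro continuous_intros linear_continuous_on matrix_vector_mul_bounded_linear)
  have "sphere 0 1 \<noteq> ({} :: (real^'d) set)" by simp
  \<comment> \<open>The lower bound is the minimum of the form on the unit sphere, extended to all
    vectors by homogeneity.\<close>
  from continuous_attains_inf[OF compact_sphere this cont]
  obtain z where z: "z \<in> sphere 0 1" "\<And>x. x \<in> sphere 0 1 \<Longrightarrow> z \<bullet> (P *v z) \<le> x \<bullet> (P *v x)"
    by auto
  define p where "p = z \<bullet> (P *v z)"
  have "z \<noteq> 0" using z(1) by auto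
  then have "p > 0" using assms by (auto simp: p_def pos_def_symmetric_def)
  moreover have "p * (norm x)\<^sup>2 \<le> x \<bullet> (P *v x)" for x
  proof (cases "x = 0")
    case False
    then have "p \<le> (x /\<^sub>R norm x) \<bullet> (P *v (x /\<^sub>R norm x))"
      unfolding p_def by (intro z) simp
    then show ?thesis
      using False by (simp add: matrix_vector_mult_scaleR power2_eq_square field_simps)
  qed simp
  ultimately show ?thesis using that q by blast
qed

lemma pos_def_symmetric_right_inverse:
  assumes "pos_def_symmetric P"
  obtains R where "P ** R = mat 1"
proof -
  have "x = 0" if "P *v x = 0" for x
    using assms that unfolding pos_def_symmetric_def by (metis inner_zero_right less_irrefl)
  then have "\<exists>R. R ** P = mat 1"
    by (simp add: matrix_left_invertible_ker)
  then show ?thesis using that by (metis matrix_left_right_inverse)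
qed

lemma pos_def_symmetric_inner:
  assumes "pos_def_symmetric P"
  shows "x \<bullet> (P *v y) = (P *v x) \<bullet> y"
  using assms by (metis dot_lmul_matrix pos_def_symmetric_def transpose_matrix_vector)

text \<open>The Riccati equation tested with \<open>x\<close> on both sides; symmetry of
  \<open>P\<close> makes the two \<open>S_mat\<close> terms equal. It evaluates the contribution of
  \<open>S_mat\<close> to the derivative of the Lyapunov function.\<close>

lemma riccati_quadratic:
  fixes P :: "real^('d::{finite,linorder})^('d::{finite,linorder})"
  assumes P: "pos_def_symmetric P"
    and riccati: "S_mat ** P + P ** transpose S_mat
      - (2 * \<mu>) *\<^sub>R (P ** transpose C_mat ** C_mat ** P) + a *\<^sub>R mat 1 = 0"
  shows "2 * (x \<bullet> (S_mat *v (P *v x))) = 2 * \<mu> * (c_vec \<bullet> (P *v x))\<^sup>2 - a * (norm x)\<^sup>2"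
proof -
  have "(S_mat ** P + P ** transpose S_mat
      - (2 * \<mu>) *\<^sub>R (P ** transpose C_mat ** C_mat ** P) + a *\<^sub>R mat 1) *v x = 0"
    by (simp add: riccati)
  then have "S_mat *v (P *v x) + P *v (transpose S_mat *v x)
      - (2 * \<mu>) *\<^sub>R (P *v (transpose C_mat *v (C_mat *v (P *v x)))) + a *\<^sub>R x = 0"
    by (simp add: matrix_vector_mult_diff_rdistrib matrix_vector_mult_add_rdistrib
        scaleR_matrix_vector_assoc[symmetric] matrix_vector_mul_assoc[symmetric]
        del: transpose_matrix_vector)
  then have "0 = x \<bullet> (S_mat *v (P *v x) + P *v (transpose S_mat *v x)
      - (2 * \<mu>) *\<^sub>R (P *v (transpose C_mat *v (C_mat *v (P *v x)))) + a *\<^sub>R x)"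
    by simp
  also have "\<dots> = x \<bullet> (S_mat *v (P *v x)) + x \<bullet> (P *v (transpose S_mat *v x))
      - 2 * \<mu> * ((c_vec \<bullet> (P *v x)) * (x \<bullet> (P *v c_vec))) + a * (norm x)\<^sup>2"
    by (simp add: inner_add_right inner_diff_right C_mat_mult transpose_C_mat_mult
        matrix_vector_mult_scaleR power2_norm_eq_inner del: transpose_matrix_vector)
  also have "x \<bullet> (P *v (transpose S_mat *v x)) = x \<bullet> (S_mat *v (P *v x))"
    by (metis P dot_lmul_matrix inner_commute pos_def_symmetric_inner transpose_matrix_vector)
  also have "x \<bullet> (P *v c_vec) = c_vec \<bullet> (P *v x)"
    by (metis P inner_commute pos_def_symmetric_inner)
  finally show ?thesis by (simp add: power2_eq_square)
qed

text \<open>\<open>R\<close> is the inverse of \<open>P\<close>, \<open>r\<close> the reference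
  node, and \<open>c\<close> measures how definite the form of the \<open>u m\<close> is. By
  \<open>gap\<close>, working with \<open>\<mu>'\<close> instead of \<open>\<mu>\<close> costs at
  most half of the dissipation \<open>a\<close>.\<close>

locale synchronization =
  fixes E :: "('n::finite \<times> 'n) set"
    and A :: "real^'n^'n"
    and \<phi> :: "real^('d::{finite,linorder}) \<Rightarrow> real"
    and P R :: "real^('d::{finite,linorder})^('d::{finite,linorder})"
    and r :: 'n and \<mu> \<mu>' a \<Lambda> c :: real and N :: nat and u :: "nat \<Rightarrow> real^'n"
  assumes graph: "comm_graph E A"
    and lipschitz: "\<Lambda>-lipschitz_on UNIV \<phi>"
    and a: "a > 0"
    and P: "pos_def_symmetric P"
    and riccati: "S_mat ** P + P ** transpose S_mat
      - (2 * \<mu>) *\<^sub>R (P ** transpose C_mat ** C_mat ** P) + a *\<^sub>R mat 1 = 0"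
    and R: "P ** R = mat 1"
    and lyapunov: "lyapunov_family (deflated A r \<mu>) \<mu>' N u"
    and c: "c > 0" "\<And>x. (norm x)\<^sup>2 \<le> c * (\<Sum>m<N. (u m \<bullet> x)\<^sup>2)"
    and gap: "4 * (\<mu> - \<mu>') * (norm (P *v c_vec))\<^sup>2 \<le> a"
begin

section \<open>Error coordinates and the Lyapunov function\<close>

definition \<eta> :: "real \<Rightarrow> (real^('d::{finite,linorder}))^'n \<Rightarrow> 'n \<Rightarrow> real^('d::{finite,linorder})" where
  "\<eta> g w k = R *v scale g (w $ k - w $ r)"

definition \<zeta> :: "real \<Rightarrow> nat \<Rightarrow> (real^('d::{finite,linorder}))^'n \<Rightarrow> real^('d::{finite,linorder})" where
  "\<zeta> g m w = (\<Sum>k\<in>UNIV. (u m $ k) *\<^sub>R \<eta> g w k)"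

text \<open>In the scaled errors \<open>P *v \<zeta> g m w\<close> this is the form of the inverse
  \<open>R\<close>; the coordinates \<open>\<zeta>\<close> absorb the inverse, so that the Riccati
  equation for \<open>P\<close> applies directly.\<close>

definition V :: "real \<Rightarrow> (real^('d::{finite,linorder}))^'n \<Rightarrow> real" where
  "V g w = (\<Sum>m<N. \<zeta> g m w \<bullet> (P *v \<zeta> g m w))"

definition X :: "real \<Rightarrow> (real^('d::{finite,linorder}))^'n \<Rightarrow> real" where
  "X g w = (\<Sum>m<N. (norm (\<zeta> g m w))\<^sup>2)"

definition field :: "real \<Rightarrow> (real^('d::{finite,linorder}))^'n \<Rightarrow> (real^('d::{finite,linorder}))^'n" where
  "field g = network_field \<phi> A (P ** transpose C_mat) g"

lemma PR: "P *v (R *v x) = x"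
  by (simp add: matrix_vector_mul_assoc R)

lemma linear_\<eta>: "linear (\<lambda>w. \<eta> g w k)"
proof -
  have "linear (\<lambda>w :: (real^('d::{finite,linorder}))^'n. w $ k - w $ r)"
    by (rule linearI) (simp_all add: algebra_simps)
  from linear_compose[OF this linear_compose[OF linear_scale matrix_vector_mul_linear]]
  show ?thesis by (simp add: \<eta>_def[abs_def] o_def)
qed

lemma bounded_linear_\<zeta>: "bounded_linear (\<zeta> g m)"
  unfolding \<zeta>_def[abs_def] linear_conv_bounded_linear[symmetric]
  by (intro linear_compose_sum ballI linear_compose_scale_right linear_\<eta>)

lemma X_nonneg: "0 \<le> X g w"
  by (simp add: X_def sum_nonneg)

lemma norm_\<zeta>_le: "m < N \<Longrightarrow> norm (\<zeta> g m w) \<le> sqrt (X g w)"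
  unfolding X_def by (intro real_le_rsqrt member_le_sum) auto

text \<open>Definiteness is used once per coordinate \<open>i\<close> of the agent space, on the
  vector over the nodes that collects the \<open>i\<close>-th entries of all errors; summing over
  \<open>i\<close> gives \<open>c * X g w\<close>.\<close>

lemma norm_\<eta>_le: "norm (\<eta> g w k) \<le> sqrt (c * X g w)"
proof -
  define x where "x i = (\<chi> k. \<eta> g w k $ i)" for i
  have ux: "u m \<bullet> x i = \<zeta> g m w $ i" for m i
    by (simp add: x_def \<zeta>_def inner_vec_def)
  have "(norm (\<eta> g w k))\<^sup>2 = (\<Sum>i\<in>UNIV. (x i $ k)\<^sup>2)"
    by (simp add: norm_vec_def L2_set_def sum_nonneg x_def)
  also have "\<dots> \<le> (\<Sum>i\<in>UNIV. (norm (x i))\<^sup>2)"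
    by (intro sum_mono) (metis component_le_norm_cart power2_abs power_mono abs_ge_zero)
  also have "\<dots> \<le> (\<Sum>i\<in>UNIV. c * (\<Sum>m<N. (\<zeta> g m w $ i)\<^sup>2))"
    using c(2)[of "x _"] by (intro sum_mono) (simp add: ux)
  also have "\<dots> = c * (\<Sum>m<N. \<Sum>i\<in>UNIV. (\<zeta> g m w $ i)\<^sup>2)"
    by (subst sum.swap) (simp add: sum_distrib_left)
  also have "\<dots> = c * X g w"
    by (simp add: X_def norm_vec_def L2_set_def sum_nonneg)
  finally show ?thesis by (rule real_le_rsqrt)
qed

section \<open>Error dynamics in the scaled coordinates\<close>

definition y :: "real \<Rightarrow> (real^('d::{finite,linorder}))^'n \<Rightarrow> real^'n" where
  "y g w = (\<chi> k. c_vec \<bullet> (P *v \<eta> g w k))"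

definition \<Delta>\<phi> :: "(real^('d::{finite,linorder}))^'n \<Rightarrow> real^'n" where
  "\<Delta>\<phi> w = (\<chi> k. \<phi> (w $ k) - \<phi> (w $ r))"

text \<open>Laplacian rows see only differences, so outputs may be measured relative to
  \<open>r\<close>. Then \<open>y g w $ r = 0\<close>, the deflation term vanishes, and
  \<open>g\<close> is the scaling of the first coordinate.\<close>

lemma laplacian_output_difference:
  assumes "g > 0"
  shows "(laplacian A *v (\<chi> j. c_vec \<bullet> w $ j)) $ k - (laplacian A *v (\<chi> j. c_vec \<bullet> w $ j)) $ r
    = g * (deflated A r \<mu> *v y g w) $ k"
proof -
  have "c_vec \<bullet> w $ i - c_vec \<bullet> w $ j = g * (y g w $ i - y g w $ j)" for i j
    using c_vec_scale[OF assms, of "w $ i - w $ j"] linear_diff[OF linear_scale, of g]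
      c_vec_scale[OF assms, of "w $ i - w $ r"] c_vec_scale[OF assms, of "w $ j - w $ r"]
    by (simp add: y_def \<eta>_def PR inner_diff_right algebra_simps)
  then have "(laplacian A *v (\<chi> j. c_vec \<bullet> w $ j)) $ k = g * (laplacian A *v y g w) $ k" for k
    by (simp add: laplacian_mult[OF graph] sum_distrib_left mult_ac)
  moreover have "y g w $ r = 0"
    by (simp add: y_def \<eta>_def linear_0[OF linear_scale])
  ultimately show ?thesis
    by (simp add: deflated_mult right_diff_distrib)
qed

text \<open>As \<open>\<eta>\<close> is linear in the state, \<open>\<eta> g (field g w) k\<close>
  is its velocity along solutions. Linear terms carry the factor \<open>g\<close>, the nonlinearity
  \<open>1 / g ^ CARD('d)\<close>.\<close>

lemma P_\<eta>_field:
  assumes "g > 0"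
  shows "P *v \<eta> g (field g w) k = g *\<^sub>R (S_mat *v (P *v \<eta> g w k))
    + (\<Delta>\<phi> w $ k / g ^ CARD('d)) *\<^sub>R b_vec
    - (g * (deflated A r \<mu> *v y g w) $ k) *\<^sub>R (P *v c_vec)"
proof -
  have "field g w $ k - field g w $ r = S_mat *v (w $ k - w $ r) + \<Delta>\<phi> w $ k *\<^sub>R b_vec
    - (g * (deflated A r \<mu> *v y g w) $ k) *\<^sub>R (D_mat g *v (P *v c_vec))"
    by (simp add: field_def network_field_component[OF graph] agent_field_eq \<Delta>\<phi>_def
        matrix_vector_mult_diff_distrib algebra_simps flip: laplacian_output_difference[OF assms])
  then have "P *v \<eta> g (field g w) k = scale g (S_mat *v (w $ k - w $ r) + \<Delta>\<phi> w $ k *\<^sub>R b_vec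
    - (g * (deflated A r \<mu> *v y g w) $ k) *\<^sub>R (D_mat g *v (P *v c_vec)))"
    by (simp add: \<eta>_def PR)
  also have "\<dots> = g *\<^sub>R (S_mat *v (P *v \<eta> g w k)) + (\<Delta>\<phi> w $ k / g ^ CARD('d)) *\<^sub>R b_vec
    - (g * (deflated A r \<mu> *v y g w) $ k) *\<^sub>R (P *v c_vec)"
    using assms by (simp add: linear_diff[OF linear_scale] linear_add[OF linear_scale]
        linear_scale[THEN linear_cmul] scale_D_mat scale_S_mat scale_b_vec \<eta>_def PR)
  finally show ?thesis .
qed

lemma P_\<zeta>: "P *v \<zeta> g m w = (\<Sum>k\<in>UNIV. (u m $ k) *\<^sub>R (P *v \<eta> g w k))"
  unfolding \<zeta>_def linear_sum[OF matrix_vector_mul_linear] by (simp add: matrix_vector_mult_scaleR)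

lemma c_vec_P_\<zeta>: "c_vec \<bullet> (P *v \<zeta> g m w) = u m \<bullet> y g w"
  by (simp add: P_\<zeta> inner_sum_right inner_vec_def[of "u m"] y_def)

lemma P_\<zeta>_field:
  assumes "g > 0"
  shows "P *v \<zeta> g m (field g w) = g *\<^sub>R (S_mat *v (P *v \<zeta> g m w))
    + ((u m \<bullet> \<Delta>\<phi> w) / g ^ CARD('d)) *\<^sub>R b_vec
    - (g * (u m \<bullet> (deflated A r \<mu> *v y g w))) *\<^sub>R (P *v c_vec)"
proof -
  have "P *v \<zeta> g m (field g w) =
      (\<Sum>k\<in>UNIV. g *\<^sub>R (S_mat *v (u m $ k *\<^sub>R (P *v \<eta> g w k))))
      + (\<Sum>k\<in>UNIV. (u m $ k * \<Delta>\<phi> w $ k / g ^ CARD('d)) *\<^sub>R b_vec)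
      - (\<Sum>k\<in>UNIV. (g * (u m $ k * (deflated A r \<mu> *v y g w) $ k)) *\<^sub>R (P *v c_vec))"
    unfolding P_\<zeta>[of g m "field g w"] P_\<eta>_field[OF assms]
    by (simp add: scaleR_add_right scaleR_diff_right sum.distrib sum_subtractf
        matrix_vector_mult_scaleR mult_ac)
  then show ?thesis
    by (simp add: P_\<zeta>[of g m w] inner_vec_def sum_distrib_left sum_divide_distrib
        linear_sum[OF matrix_vector_mul_linear] scaleR_sum_right scaleR_sum_left)
qed

text \<open>The left-hand side is the derivative of \<open>V\<close> along solutions. Per unit of
  \<open>g\<close>, Riccati gives \<open>2 \<mu> Y - a X\<close> with \<open>Y\<close> the sum of
  the squared \<open>u m \<bullet> y g w\<close>, and the coupling at most
  \<open>- 2 \<mu>' Y\<close>. By \<open>gap\<close> the balance is at most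
  \<open>- (a / 2) X\<close>, which beats the nonlinearity for large \<open>g\<close>.\<close>

lemma exists_gain:
  obtains g0 where "g0 \<ge> 1"
    and "\<And>g w. g \<ge> g0 \<Longrightarrow> 2 * (\<Sum>m<N. \<zeta> g m w \<bullet> (P *v \<zeta> g m (field g w))) \<le> - V g w"
proof -
  obtain q where q: "q > 0" "\<And>x. norm (P *v x) \<le> q * norm x"
    using pos_def_symmetric_bounds[OF P] by metis
  define U where "U = (\<Sum>m<N. norm (u m))"
  define B where "B = norm (b_vec :: real^('d::{finite,linorder}))"
  \<comment> \<open>\<open>D\<close> bounds the differences of \<open>\<phi>\<close> per unit of
    \<open>g ^ CARD('d) * sqrt (X g w)\<close>, and \<open>\<kappa>\<close> their whole contribution
    per unit of \<open>X g w\<close>; neither depends on \<open>g\<close>.\<close>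
  define D where "D = CARD('n) * (\<Lambda> * q * sqrt c)"
  define \<kappa> where "\<kappa> = 2 * (U * D * B)"
  have \<Lambda>: "0 \<le> \<Lambda>" using lipschitz by (rule lipschitz_on_nonneg)
  \<comment> \<open>The threshold says \<open>g * (a / 2) \<ge> \<kappa> + q\<close>:
    \<open>\<kappa>\<close> cancels the nonlinearity, and the remaining \<open>- q * X g w\<close>
    lies below \<open>- V g w\<close>.\<close>
  have "2 * (\<Sum>m<N. \<zeta> g m w \<bullet> (P *v \<zeta> g m (field g w))) \<le> - V g w"
    if g: "g \<ge> 1" "2 * (\<kappa> + q) / a \<le> g" for g w
  proof -
    let ?d = "g ^ CARD('d)"
    let ?x = "sqrt (X g w)"
    have xx: "?x * ?x = X g w" by (simp add: X_nonneg)
    have \<Delta>\<phi>_le: "norm (\<Delta>\<phi> w) \<le> ?d * (D * ?x)"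
    proof -
      have "norm (\<Delta>\<phi> w $ k) \<le> \<Lambda> * (?d * (q * (sqrt c * ?x)))" for k
      proof -
        have "norm (\<Delta>\<phi> w $ k) \<le> \<Lambda> * norm (w $ k - w $ r)"
          using lipschitz_onD[OF lipschitz, of "w $ k" "w $ r"] by (simp add: \<Delta>\<phi>_def dist_norm)
        also have "norm (w $ k - w $ r) \<le> ?d * norm (P *v \<eta> g w k)"
          unfolding \<eta>_def PR by (rule norm_le_norm_scale[OF g(1)])
        also have "norm (P *v \<eta> g w k) \<le> q * norm (\<eta> g w k)" by (rule q)
        also have "norm (\<eta> g w k) \<le> sqrt c * ?x"
          using norm_\<eta>_le by (simp add: real_sqrt_mult)
        finally show ?thesis using \<Lambda> g(1) q(1) by (simp add: mult_left_mono)
      qed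
      then have "(\<Sum>k\<in>UNIV. norm (\<Delta>\<phi> w $ k)) \<le> CARD('n) * (\<Lambda> * (?d * (q * (sqrt c * ?x))))"
        by (intro sum_bounded_above) auto
      moreover have "norm (\<Delta>\<phi> w) \<le> (\<Sum>k\<in>UNIV. norm (\<Delta>\<phi> w $ k))"
        unfolding norm_vec_def by (rule L2_set_le_sum) simp
      ultimately show ?thesis by (simp add: D_def mult_ac)
    qed
    have term_le: "2 * (\<zeta> g m w \<bullet> (P *v \<zeta> g m (field g w)))
      \<le> g * (2 * \<mu> * (u m \<bullet> y g w)\<^sup>2 - a * (norm (\<zeta> g m w))\<^sup>2)
        + 2 * norm (u m) * (D * B * X g w)
        - 2 * g * ((u m \<bullet> y g w) * (u m \<bullet> (deflated A r \<mu> *v y g w)))" if m: "m < N" for m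
    proof -
      let ?z = "\<zeta> g m w"
      have "(u m \<bullet> \<Delta>\<phi> w) / ?d * (?z \<bullet> b_vec) \<le> norm (u m) * (D * ?x) * (?x * B)"
      proof -
        have "\<bar>u m \<bullet> \<Delta>\<phi> w\<bar> \<le> norm (u m) * (?d * (D * ?x))"
          using Cauchy_Schwarz_ineq2[of "u m" "\<Delta>\<phi> w"] \<Delta>\<phi>_le
          by (meson mult_left_mono norm_ge_zero order_trans)
        then have 1: "\<bar>(u m \<bullet> \<Delta>\<phi> w) / ?d\<bar> \<le> norm (u m) * (D * ?x)"
          using g(1) by (simp add: abs_divide divide_le_eq mult_ac)
        have "\<bar>?z \<bullet> b_vec\<bar> \<le> norm ?z * B"
          unfolding B_def by (rule Cauchy_Schwarz_ineq2)
        also have "\<dots> \<le> ?x * B"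
          using norm_\<zeta>_le[OF m] by (intro mult_right_mono) (auto simp: B_def)
        finally have 2: "\<bar>?z \<bullet> b_vec\<bar> \<le> ?x * B" .
        have "\<bar>(u m \<bullet> \<Delta>\<phi> w) / ?d * (?z \<bullet> b_vec)\<bar> \<le> norm (u m) * (D * ?x) * (?x * B)"
          unfolding abs_mult[of _ "?z \<bullet> b_vec"]
          using 1 2 order_trans[OF abs_ge_zero 1] by (intro mult_mono) auto
        then show ?thesis by linarith
      qed
      also have "\<dots> = norm (u m) * (D * B * (?x * ?x))"
        by (simp only: mult_ac)
      finally have pert: "(u m \<bullet> \<Delta>\<phi> w) / ?d * (?z \<bullet> b_vec) \<le> norm (u m) * (D * B * X g w)"
        by (simp only: xx)
      have "?z \<bullet> (P *v c_vec) = u m \<bullet> y g w"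
        by (metis c_vec_P_\<zeta> inner_commute pos_def_symmetric_inner[OF P])
      then have "2 * (?z \<bullet> (P *v \<zeta> g m (field g w)))
        = g * (2 * (?z \<bullet> (S_mat *v (P *v ?z)))) + 2 * ((u m \<bullet> \<Delta>\<phi> w) / ?d * (?z \<bullet> b_vec))
          - 2 * g * ((u m \<bullet> y g w) * (u m \<bullet> (deflated A r \<mu> *v y g w)))"
        using g(1) by (simp add: P_\<zeta>_field inner_add_right inner_diff_right algebra_simps)
      then show ?thesis
        using pert by (simp add: riccati_quadratic[OF P riccati] c_vec_P_\<zeta>)
    qed
    have u_y: "2 * (\<mu> - \<mu>') * (\<Sum>m<N. (u m \<bullet> y g w)\<^sup>2) \<le> a / 2 * X g w"
    \<comment> \<open>The locale leaves the sign of \<open>\<mu> - \<mu>'\<close> open; if it is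
      positive, Cauchy-Schwarz bounds the outputs by the states and \<open>gap\<close>
      applies.\<close>
    proof (cases "\<mu> \<le> \<mu>'")
      case True
      then have "2 * (\<mu> - \<mu>') \<le> 0" by simp
      then have "2 * (\<mu> - \<mu>') * (\<Sum>m<N. (u m \<bullet> y g w)\<^sup>2) \<le> 0"
        by (rule mult_nonpos_nonneg) (simp add: sum_nonneg)
      also have "0 \<le> a / 2 * X g w" using a X_nonneg by simp
      finally show ?thesis .
    next
      case False
      have "(u m \<bullet> y g w)\<^sup>2 \<le> (norm (P *v c_vec))\<^sup>2 * (norm (\<zeta> g m w))\<^sup>2" for m
      proof -
        have "\<bar>u m \<bullet> y g w\<bar> \<le> norm (P *v c_vec) * norm (\<zeta> g m w)"
          by (metis c_vec_P_\<zeta> pos_def_symmetric_inner[OF P] Cauchy_Schwarz_ineq2)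
        then show ?thesis
          by (metis abs_ge_zero power2_abs power_mono power_mult_distrib)
      qed
      then have "(\<Sum>m<N. (u m \<bullet> y g w)\<^sup>2) \<le> (norm (P *v c_vec))\<^sup>2 * X g w"
        unfolding X_def sum_distrib_left by (intro sum_mono) auto
      then have "2 * (\<mu> - \<mu>') * (\<Sum>m<N. (u m \<bullet> y g w)\<^sup>2)
          \<le> 2 * (\<mu> - \<mu>') * ((norm (P *v c_vec))\<^sup>2 * X g w)"
        using False by (intro mult_left_mono) auto
      also have "\<dots> = (4 * (\<mu> - \<mu>') * (norm (P *v c_vec))\<^sup>2) * (X g w / 2)" by simp
      also have "\<dots> \<le> a * (X g w / 2)"
        using gap X_nonneg by (intro mult_right_mono) auto
      finally show ?thesis by simp
    qed
    have V_le: "V g w \<le> q * X g w"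
    proof -
      have "\<zeta> g m w \<bullet> (P *v \<zeta> g m w) \<le> q * (norm (\<zeta> g m w))\<^sup>2" for m
      proof -
        have "\<zeta> g m w \<bullet> (P *v \<zeta> g m w) \<le> norm (\<zeta> g m w) * norm (P *v \<zeta> g m w)"
          by (rule norm_cauchy_schwarz)
        also have "\<dots> \<le> norm (\<zeta> g m w) * (q * norm (\<zeta> g m w))"
          by (intro mult_left_mono q) auto
        finally show ?thesis by (simp add: power2_eq_square mult_ac)
      qed
      then show ?thesis unfolding V_def X_def sum_distrib_left by (intro sum_mono)
    qed
    have "2 * (\<Sum>m<N. \<zeta> g m w \<bullet> (P *v \<zeta> g m (field g w)))
      \<le> (\<Sum>m<N. g * (2 * \<mu> * (u m \<bullet> y g w)\<^sup>2 - a * (norm (\<zeta> g m w))\<^sup>2)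
        + 2 * norm (u m) * (D * B * X g w)
        - 2 * g * ((u m \<bullet> y g w) * (u m \<bullet> (deflated A r \<mu> *v y g w))))"
      unfolding sum_distrib_left by (intro sum_mono term_le) auto
    also have "\<dots> = g * (2 * \<mu> * (\<Sum>m<N. (u m \<bullet> y g w)\<^sup>2) - a * X g w) + \<kappa> * X g w
        - 2 * g * (\<Sum>m<N. (u m \<bullet> y g w) * (u m \<bullet> (deflated A r \<mu> *v y g w)))"
      by (simp add: sum.distrib sum_subtractf X_def U_def \<kappa>_def right_diff_distrib
          sum_distrib_left[symmetric] sum_distrib_right[symmetric] mult.assoc)
    \<comment> \<open>Here the spectrum of the graph enters, through the Lyapunov inequality at the
      vector \<open>y g w\<close>.\<close>
    also have "\<dots> \<le> g * (2 * \<mu> * (\<Sum>m<N. (u m \<bullet> y g w)\<^sup>2) - a * X g w) + \<kappa> * X g w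
        - 2 * g * (\<mu>' * (\<Sum>m<N. (u m \<bullet> y g w)\<^sup>2))"
      using lyapunov g(1) by (simp add: lyapunov_family_def)
    also have "\<dots> = g * (2 * (\<mu> - \<mu>') * (\<Sum>m<N. (u m \<bullet> y g w)\<^sup>2) - a * X g w) + \<kappa> * X g w"
      by (simp add: algebra_simps)
    also have "\<dots> \<le> g * (a / 2 * X g w - a * X g w) + \<kappa> * X g w"
      using u_y g(1) by (intro add_right_mono mult_left_mono diff_right_mono) auto
    also have "\<dots> = (\<kappa> - g * (a / 2)) * X g w" by (simp add: algebra_simps)
    also have "\<dots> \<le> - q * X g w"
      using g(2) a X_nonneg by (intro mult_right_mono) (auto simp: field_simps)
    also have "\<dots> \<le> - V g w" using V_le by simp
    finally show ?thesis .
  qed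
  then show ?thesis
    by (intro that[of "max 1 (2 * (\<kappa> + q) / a)"]) auto
qed

text \<open>As \<open>V\<close> is quadratic, its decay \<open>exp (- t)\<close> becomes
  \<open>exp (- t / 2)\<close> for the errors. The constant may depend on \<open>g\<close>, but not
  on the solution.\<close>

lemma synchronization_error_decay:
  obtains g0 where "g0 \<ge> 1"
    and "\<And>g. g \<ge> g0 \<Longrightarrow> \<exists>K>0. \<forall>w0 w t k. is_free_solution (field g) w0 w \<longrightarrow> 0 \<le> t \<longrightarrow>
      norm (w t $ k - w t $ r) \<le> K * exp (- t / 2) * (\<Sum>j\<in>UNIV. norm (w0 $ j - w0 $ r))"
proof -
  obtain g0 where g0: "g0 \<ge> 1"
    "\<And>g w. g \<ge> g0 \<Longrightarrow> 2 * (\<Sum>m<N. \<zeta> g m w \<bullet> (P *v \<zeta> g m (field g w))) \<le> - V g w"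
    by (rule exists_gain) blast
  obtain p q where pq: "p > 0" "\<And>x. p * (norm x)\<^sup>2 \<le> x \<bullet> (P *v x)"
    "q > 0" "\<And>x. norm (P *v x) \<le> q * norm x"
    using pos_def_symmetric_bounds[OF P] by blast
  show ?thesis
  proof (rule that[OF g0(1)])
    fix g assume g: "g \<ge> g0"
    have g1: "g \<ge> 1" using g g0(1) by simp
    have "linear (\<lambda>x. R *v scale g x)"
      using linear_compose[OF linear_scale matrix_vector_mul_linear] by (simp add: o_def)
    from linear_bounded_pos[OF this]
    obtain b where b: "b > 0" "\<And>x. norm (R *v scale g x) \<le> b * norm x" by blast
    define U where "U = (\<Sum>m<N. norm (u m))"
    \<comment> \<open>\<open>g ^ CARD('d) * q\<close> recovers the errors from
      \<open>\<eta>\<close>, the root passes from the initial \<open>\<zeta>\<close> to the present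
      \<open>\<eta>\<close> by way of \<open>V\<close>, and \<open>U * b\<close> bounds the initial
      \<open>\<zeta>\<close> by the initial errors.\<close>
    define K where "K = g ^ CARD('d) * q * sqrt (c * (q * N) / p) * U * b"
    have K_le: "norm (w t $ k - w t $ r) \<le> K * exp (- t / 2) * (\<Sum>j\<in>UNIV. norm (w0 $ j - w0 $ r))"
      if w: "is_free_solution (field g) w0 w" and t: "0 \<le> t" for w0 w t k
    proof -
      let ?s = "\<Sum>j\<in>UNIV. norm (w0 $ j - w0 $ r)"
      have dw: "(w has_vector_derivative field g (w t)) (at t within {0..})" if "0 \<le> t" for t
        using w that by (simp add: is_solution_def)
      have d\<zeta>: "((\<lambda>t. \<zeta> g m (w t)) has_vector_derivative \<zeta> g m (field g (w t))) (at t within {0..})"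
        if "0 \<le> t" for t m
        using bounded_linear.has_vector_derivative[OF bounded_linear_\<zeta> dw[OF that]] .
      have "((\<lambda>t. V g (w t)) has_real_derivative
          2 * (\<Sum>m<N. \<zeta> g m (w t) \<bullet> (P *v \<zeta> g m (field g (w t))))) (at t within {0..})"
        if "0 \<le> t" for t
      proof -
        have "((\<lambda>t. V g (w t)) has_vector_derivative
          (\<Sum>m<N. \<zeta> g m (w t) \<bullet> (P *v \<zeta> g m (field g (w t)))
            + \<zeta> g m (field g (w t)) \<bullet> (P *v \<zeta> g m (w t)))) (at t within {0..})"
          unfolding V_def
          by (intro has_vector_derivative_sum bounded_bilinear.has_vector_derivative[OF bounded_bilinear_inner]
              bounded_linear.has_vector_derivative[OF matrix_vector_mul_bounded_linear] d\<zeta> that)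
        moreover have "\<zeta> g m (field g (w t)) \<bullet> (P *v \<zeta> g m (w t))
            = \<zeta> g m (w t) \<bullet> (P *v \<zeta> g m (field g (w t)))" for m
          by (metis inner_commute pos_def_symmetric_inner[OF P])
        ultimately show ?thesis
          by (simp add: has_real_derivative_iff_has_vector_derivative sum_distrib_left)
      qed
      from exp_decay[OF this g0(2)[OF g] t]
      have V: "V g (w t) \<le> V g w0 * exp (- t)"
        using w by (simp add: is_solution_def)
      have \<zeta>0: "norm (\<zeta> g m w0) \<le> U * b * ?s" if "m < N" for m
      proof -
        have "norm (\<zeta> g m w0) \<le> (\<Sum>k\<in>UNIV. norm ((u m $ k) *\<^sub>R \<eta> g w0 k))"
          unfolding \<zeta>_def by (rule norm_sum)
        also have "\<dots> \<le> (\<Sum>k\<in>UNIV. U * (b * norm (w0 $ k - w0 $ r)))"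
        proof (intro sum_mono)
          fix k
          have "\<bar>u m $ k\<bar> \<le> norm (u m)" by (rule component_le_norm_cart)
          also have "\<dots> \<le> U" unfolding U_def using that by (intro member_le_sum) auto
          finally show "norm ((u m $ k) *\<^sub>R \<eta> g w0 k) \<le> U * (b * norm (w0 $ k - w0 $ r))"
            using b by (auto simp: \<eta>_def intro!: mult_mono)
        qed
        finally show ?thesis by (simp add: sum_distrib_left mult_ac)
      qed
      have s0: "0 \<le> ?s" by (intro sum_nonneg) auto
      have U0: "0 \<le> U" by (auto simp: U_def intro: sum_nonneg)
      have "V g w0 \<le> (\<Sum>m<N. q * (U * b * ?s)\<^sup>2)"
        unfolding V_def
      proof (intro sum_mono)
        fix m assume "m \<in> {..<N}"
        have "\<zeta> g m w0 \<bullet> (P *v \<zeta> g m w0) \<le> norm (\<zeta> g m w0) * (q * norm (\<zeta> g m w0))"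
          by (rule order_trans[OF norm_cauchy_schwarz]) (intro mult_left_mono pq, simp)
        also have "\<dots> = q * (norm (\<zeta> g m w0))\<^sup>2" by (simp add: power2_eq_square mult_ac)
        also have "\<dots> \<le> q * (U * b * ?s)\<^sup>2"
          using \<zeta>0[of m] \<open>m \<in> {..<N}\<close> pq by (intro mult_left_mono power_mono) auto
        finally show "\<zeta> g m w0 \<bullet> (P *v \<zeta> g m w0) \<le> q * (U * b * ?s)\<^sup>2" .
      qed
      then have V0: "V g w0 \<le> q * N * (U * b * ?s)\<^sup>2" by (simp add: mult_ac)
      have "p * X g (w t) \<le> V g (w t)"
        unfolding X_def V_def sum_distrib_left by (intro sum_mono pq)
      also have "\<dots> \<le> q * N * (U * b * ?s)\<^sup>2 * exp (- t)"
        by (rule order_trans[OF V]) (intro mult_right_mono V0, simp)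
      finally have X: "X g (w t) \<le> q * N / p * ((U * b * ?s)\<^sup>2 * exp (- t))"
        using pq(1) by (simp add: field_simps)
      have "norm (w t $ k - w t $ r) \<le> g ^ CARD('d) * norm (P *v \<eta> g (w t) k)"
        unfolding \<eta>_def PR by (rule norm_le_norm_scale[OF g1])
      also have "\<dots> \<le> g ^ CARD('d) * (q * sqrt (c * X g (w t)))"
        using g1 pq(3) by (intro mult_left_mono order_trans[OF pq(4)] norm_\<eta>_le) auto
      also have "\<dots> \<le> g ^ CARD('d) * (q * sqrt (c * (q * N / p * ((U * b * ?s)\<^sup>2 * exp (- t)))))"
        using g1 pq(3) c(1) X by (intro mult_left_mono real_sqrt_le_mono) auto
      also have "sqrt (c * (q * N / p * ((U * b * ?s)\<^sup>2 * exp (- t))))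
          = sqrt (c * (q * N) / p) * (U * b * ?s * exp (- t / 2))"
      proof -
        have "(U * b * ?s)\<^sup>2 * exp (- t) = (U * b * ?s * exp (- t / 2))\<^sup>2"
          by (simp add: power_mult_distrib power2_eq_square[of "exp _"] flip: exp_add)
        moreover have "0 \<le> U * b * ?s * exp (- t / 2)" using U0 s0 b(1) by simp
        ultimately have "sqrt ((U * b * ?s)\<^sup>2 * exp (- t)) = U * b * ?s * exp (- t / 2)"
          by (simp only: real_sqrt_abs abs_of_nonneg)
        moreover have "c * (q * N / p * ((U * b * ?s)\<^sup>2 * exp (- t)))
            = c * (q * N) / p * ((U * b * ?s)\<^sup>2 * exp (- t))" by simp
        ultimately show ?thesis by (metis real_sqrt_mult)
      qed
      finally show ?thesis by (simp add: K_def mult_ac)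
    qed
    have "0 \<le> K"
      using g1 pq c(1) b by (auto simp: K_def U_def intro!: mult_nonneg_nonneg sum_nonneg)
    have "norm (w t $ k - w t $ r) \<le> (K + 1) * exp (- t / 2) * (\<Sum>j\<in>UNIV. norm (w0 $ j - w0 $ r))"
      if w: "is_free_solution (field g) w0 w" and t: "0 \<le> t" for w0 w t k
      by (rule order_trans[OF K_le[OF w t]]) (intro mult_right_mono sum_nonneg; simp)
    moreover have "K + 1 > 0" using \<open>0 \<le> K\<close> by simp
    ultimately show "\<exists>K>0. \<forall>w0 w t k. is_free_solution (field g) w0 w \<longrightarrow> 0 \<le> t \<longrightarrow>
      norm (w t $ k - w t $ r) \<le> K * exp (- t / 2) * (\<Sum>j\<in>UNIV. norm (w0 $ j - w0 $ r))"
      by blast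
  qed
qed

end

section \<open>From synchronization to stability of the synchronous set\<close>

lemma sync_set_eq_image: "sync_set W = (\<lambda>p. \<chi> k. p) ` W"
proof -
  have "x \<in> (\<lambda>p. \<chi> k. p) ` W" if "x \<in> sync_set W" for x :: "'a^'n"
  proof -
    obtain r :: 'n where True by simp
    have "x = (\<chi> k. x $ r)" "x $ r \<in> W"
      using that by (auto simp: sync_set_def vec_eq_iff)
    then show ?thesis by blast
  qed
  then show ?thesis by (auto simp: sync_set_def)
qed

lemma compact_sync_set:
  fixes W :: "'a::real_normed_vector set"
  assumes "compact W"
  shows "compact (sync_set W :: ('a^'n) set)"
  unfolding sync_set_eq_image
  by (intro compact_continuous_image continuous_intros assms)

lemma norm_vec_le_sum: "norm (x :: 'a::real_normed_vector^'n) \<le> (\<Sum>k\<in>UNIV. norm (x $ k))"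
  unfolding norm_vec_def by (rule L2_set_le_sum) simp

text \<open>Compare \<open>x\<close> with \<open>(p, ..., p)\<close>, where \<open>p\<close> is a
  point of \<open>W\<close> nearest to \<open>x $ r\<close>.\<close>

lemma infdist_sync_set_le:
  fixes x :: "'a::euclidean_space^'n"
  assumes "compact W" "W \<noteq> {}"
  shows "infdist x (sync_set W) \<le> CARD('n) * infdist (x $ r) W + (\<Sum>k\<in>UNIV. norm (x $ k - x $ r))"
proof -
  obtain p where p: "p \<in> W" "infdist (x $ r) W = dist (x $ r) p"
    using infdist_attains_inf[OF compact_imp_closed] assms by metis
  have "infdist x (sync_set W) \<le> norm (x - (\<chi> k. p))"
    unfolding dist_norm[symmetric] using p(1) by (intro infdist_le) (auto simp: sync_set_def)
  also have "\<dots> \<le> (\<Sum>k\<in>UNIV. norm (x $ k - p))"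
    using norm_vec_le_sum[of "x - (\<chi> k. p)"] by simp
  also have "\<dots> \<le> (\<Sum>k\<in>UNIV. norm (x $ k - x $ r) + norm (x $ r - p))"
    by (intro sum_mono) norm
  finally show ?thesis by (simp add: sum.distrib p(2) dist_norm)
qed

text \<open>A nearest synchronous point has equal components, so every \<open>x $ k\<close> is close
  to the common value; passing through it gives the factor 2.\<close>

lemma le_infdist_sync_set:
  fixes x :: "'a::euclidean_space^'n"
  assumes "compact W" "W \<noteq> {}"
  shows "infdist (x $ r) W \<le> infdist x (sync_set W)"
    and "(\<Sum>k\<in>UNIV. norm (x $ k - x $ r)) \<le> 2 * CARD('n) * infdist x (sync_set W)"
proof -
  have "sync_set W \<noteq> ({} :: ('a^'n) set)"
    using assms(2) by (auto simp: sync_set_eq_image)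
  then obtain q where q: "q \<in> sync_set W" "infdist x (sync_set W) = dist x q"
    using infdist_attains_inf[OF compact_imp_closed[OF compact_sync_set[OF assms(1)]]] by metis
  have k: "dist (x $ k) (q $ r) \<le> infdist x (sync_set W)" for k
    using q dist_vec_nth_le[of x k q] by (auto simp: sync_set_def) metis
  have "q $ r \<in> W" using q(1) by (auto simp: sync_set_def)
  then show "infdist (x $ r) W \<le> infdist x (sync_set W)"
    using k[of r] by (intro infdist_le2)
  have "norm (x $ k - x $ r) \<le> 2 * infdist x (sync_set W)" for k
    using k[of k] k[of r] by norm
  then have "(\<Sum>k\<in>UNIV. norm (x $ k - x $ r)) \<le> of_nat CARD('n) * (2 * infdist x (sync_set W))"
    by (intro sum_bounded_above) auto
  then show "(\<Sum>k\<in>UNIV. norm (x $ k - x $ r)) \<le> 2 * CARD('n) * infdist x (sync_set W)"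
    by simp
qed

section \<open>Inputs, comparison functions and time shifts\<close>

lemma admissible_input_continuous:
  assumes "continuous_on {0..} v"
  shows "admissible_input v"
proof -
  have c: "continuous (at t within {0..}) v" if "0 \<le> t" for t
    using assms that by (auto simp: continuous_on_eq_continuous_within)
  have "(v \<longlongrightarrow> v t) (at_right t)" if "0 \<le> t" for t
    using c[OF that] unfolding continuous_within
    by (rule tendsto_within_subset) (use that in auto)
  moreover have "(v \<longlongrightarrow> v t) (at_left t)" if "0 < t" for t
  proof -
    have "at t within {0..} = at t" using that by (intro at_within_interior) simp
    then show ?thesis
      using c[of t] that unfolding continuous_within
      by (metis less_imp_le tendsto_within_subset subset_UNIV)
  qed
  moreover have "{t \<in> {0..T}. \<not> continuous (at t within {0..}) v} = {}" for T
    using c by auto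
  ultimately show ?thesis unfolding admissible_input_def by (metis finite.emptyI)
qed

lemma sup_norm_before_le:
  assumes "\<And>s. 0 \<le> s \<Longrightarrow> norm (v s) \<le> M"
  shows "0 \<le> sup_norm_before v t" "sup_norm_before v t \<le> M"
proof -
  have "0 \<le> M" using assms[of 0] norm_ge_zero order_trans by blast
  then have le: "y \<le> M" if "y \<in> insert 0 ((\<lambda>s. norm (v s)) ` {0..<t})" for y
    using that assms by auto
  show "0 \<le> sup_norm_before v t"
    unfolding sup_norm_before_def by (rule cSup_upper) (use le in \<open>auto intro!: bdd_aboveI[of _ M]\<close>)
  show "sup_norm_before v t \<le> M"
    unfolding sup_norm_before_def by (rule cSup_least) (use le in auto)
qed

lemma class_K_mono: "class_K h \<Longrightarrow> 0 \<le> d \<Longrightarrow> d \<le> e \<Longrightarrow> h d \<le> h e"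
  using strict_mono_onD[of "{0..}" h d e] by (cases "d = e") (auto simp: class_K_def)

lemma has_vector_derivative_time_shift:
  assumes "(x has_vector_derivative x') (at (T + s) within {0..})" "0 \<le> T" "(0::real) \<le> s"
  shows "((\<lambda>s. x (T + s)) has_vector_derivative x') (at s within {0..})"
proof -
  have "((+) T has_vector_derivative 1) (at s within {0..})"
    by (auto intro!: derivative_eq_intros)
  moreover have "(x has_vector_derivative x') (at (T + s) within (+) T ` {0..})"
    by (rule has_vector_derivative_within_subset[OF assms(1)]) (use assms(2) in auto)
  ultimately show ?thesis
    using vector_diff_chain_within by (force simp: o_def)
qed

text \<open>
  The reference node \<open>r\<close> is the isolated agent driven by the coupling term, which decays with the
  synchronization error. Restarting at time \<open>T\<close> makes this input arbitrarily small, hence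
  input-to-state stability forces the reference trajectory towards \<open>W\<close>.
\<close>

locale synchronizing =
  fixes F :: "'a::euclidean_space \<Rightarrow> 'a" and G :: "'a^'n \<Rightarrow> 'a^'n" and W :: "'a set"
    and r :: 'n and K \<kappa> :: real
  assumes W: "compact W" "W \<noteq> {}" "invariant_set F W" "iss_relative F W"
    and continuous: "continuous_on UNIV F" "continuous_on UNIV G"
    and solvable: "\<And>x0. \<exists>x. is_free_solution G x0 x"
    and K: "0 \<le> K" "\<And>x0 x t k. is_free_solution G x0 x \<Longrightarrow> 0 \<le> t \<Longrightarrow>
      norm (x t $ k - x t $ r) \<le> K * exp (- t / 2) * (\<Sum>j\<in>UNIV. norm (x0 $ j - x0 $ r))"
    and \<kappa>: "0 \<le> \<kappa>" "\<And>x e. (\<And>j. norm (x $ j - x $ r) \<le> e) \<Longrightarrow> norm (G x $ r - F (x $ r)) \<le> \<kappa> * e"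
begin

lemma reference_is_solution:
  assumes "is_free_solution G x0 x" "0 \<le> T"
  defines "v \<equiv> \<lambda>s. G (x (T + s)) $ r - F (x (T + s) $ r)"
  shows "is_solution F v (x T $ r) (\<lambda>s. x (T + s) $ r)" "admissible_input v"
proof -
  have x: "continuous_on {0..} x"
    "\<And>t. 0 \<le> t \<Longrightarrow> (x has_vector_derivative G (x t)) (at t within {0..})"
    using assms(1) by (auto simp: is_solution_def)
  have cx: "continuous_on {0..} (\<lambda>s. x (T + s))"
    using assms(2) by (intro continuous_on_compose2[OF x(1)] continuous_intros) auto
  have "continuous_on {0..} v"
    unfolding v_def
    by (intro continuous_intros continuous_on_compose2[OF continuous(1)]
        continuous_on_compose2[OF continuous(2)] cx) auto
  then show "admissible_input v" by (rule admissible_input_continuous)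
  have "((\<lambda>s. x (T + s) $ r) has_vector_derivative F (x (T + s) $ r) + v s) (at s within {0..})"
    if "0 \<le> s" for s
  proof -
    have "((\<lambda>s. x (T + s)) has_vector_derivative G (x (T + s))) (at s within {0..})"
      using assms(2) that by (intro has_vector_derivative_time_shift x(2)) auto
    from bounded_linear.has_vector_derivative[OF bounded_linear_vec_nth this]
    show ?thesis by (simp add: v_def)
  qed
  moreover have "continuous_on {0..} (\<lambda>s. x (T + s) $ r)"
    by (intro continuous_intros cx)
  ultimately show "is_solution F v (x T $ r) (\<lambda>s. x (T + s) $ r)"
    by (simp add: is_solution_def)
qed

text \<open>Zero initial error stays zero by the decay estimate; then the coupling at
  \<open>r\<close> vanishes, and the reference follows \<open>F\<close> inside the invariant
  \<open>W\<close>.\<close>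

lemma invariant_sync_set: "invariant_set G (sync_set W)"
  unfolding invariant_set_def
proof (intro ballI allI impI)
  fix x0 x t assume x0: "x0 \<in> sync_set W" and x: "is_free_solution G x0 x" and t: "(0::real) \<le> t"
  have "norm (x0 $ j - x0 $ r) = 0" for j
    using x0 by (simp add: sync_set_def)
  then have "(\<Sum>j\<in>UNIV. norm (x0 $ j - x0 $ r)) = 0"
    by (simp only: sum.neutral_const)
  then have eq: "x s $ j = x s $ r" if "0 \<le> s" for s j
    using K(2)[OF x that, of j] by simp
  then have GF: "G (x s) $ r = F (x s $ r)" if "0 \<le> s" for s
  proof -
    have "norm (x s $ j - x s $ r) \<le> 0" for j by (subst eq[OF that]) simp
    from \<kappa>(2)[OF this] show ?thesis by simp
  qed
  have "((\<lambda>s. x s $ r) has_vector_derivative F (x s $ r)) (at s within {0..})" if "0 \<le> s" for s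
  proof -
    have "(x has_vector_derivative G (x s)) (at s within {0..})"
      using x that by (simp add: is_solution_def)
    from bounded_linear.has_vector_derivative[OF bounded_linear_vec_nth[of r] this]
    show ?thesis by (simp add: GF[OF that])
  qed
  moreover from this have "continuous_on {0..} (\<lambda>s. x s $ r)"
    by (intro continuous_on_vector_derivative) auto
  ultimately have "is_free_solution F (x 0 $ r) (\<lambda>s. x s $ r)"
    by (simp add: is_solution_def)
  moreover have "x 0 $ r \<in> W"
    using x x0 by (auto simp: is_solution_def sync_set_def)
  ultimately have "x t $ r \<in> W"
    using W(3) t by (auto simp: invariant_set_def)
  then have "x t $ k \<in> W" for k
    by (simp only: eq[OF t, of k])
  moreover have "x t $ j = x t $ k" for j k
    by (simp only: eq[OF t, of j] eq[OF t, of k])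
  ultimately show "x t \<in> sync_set W"
    unfolding sync_set_def by blast
qed

lemma reference_iss:
  obtains \<beta> \<gamma> where "class_KL \<beta>" "class_K \<gamma>"
    and "\<And>x0 x T t. is_free_solution G x0 x \<Longrightarrow> 0 \<le> T \<Longrightarrow> 0 \<le> t \<Longrightarrow>
      infdist (x (T + t) $ r) W \<le> max (\<beta> (infdist (x T $ r) W) t)
        (\<gamma> (\<kappa> * (K * exp (- T / 2) * (\<Sum>j\<in>UNIV. norm (x0 $ j - x0 $ r)))))"
proof -
  obtain \<beta> \<gamma> where \<beta>\<gamma>: "class_KL \<beta>" "class_K \<gamma>"
    "\<And>x0 v x t. admissible_input v \<Longrightarrow> is_solution F v x0 x \<Longrightarrow> 0 \<le> t \<Longrightarrow>
      infdist (x t) W \<le> max (\<beta> (infdist x0 W) t) (\<gamma> (sup_norm_before v t))"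
    using W(4) unfolding iss_relative_def by blast
  show ?thesis
  proof (rule that[OF \<beta>\<gamma>(1,2)])
    fix x0 x and T t :: real
    assume x: "is_free_solution G x0 x" and T: "0 \<le> T" and t: "0 \<le> t"
    let ?s = "\<Sum>j\<in>UNIV. norm (x0 $ j - x0 $ r)"
    let ?v = "\<lambda>s. G (x (T + s)) $ r - F (x (T + s) $ r)"
    have s: "0 \<le> ?s" by (intro sum_nonneg) auto
    have v: "norm (?v s) \<le> \<kappa> * (K * exp (- T / 2) * ?s)" if "0 \<le> s" for s
    proof (rule \<kappa>(2))
      fix j
      have "norm (x (T + s) $ j - x (T + s) $ r) \<le> K * exp (- (T + s) / 2) * ?s"
        using T that by (intro K(2)[OF x]) auto
      also have "\<dots> \<le> K * exp (- T / 2) * ?s"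
        using that K(1) s by (intro mult_right_mono mult_left_mono) auto
      finally show "norm (x (T + s) $ j - x (T + s) $ r) \<le> K * exp (- T / 2) * ?s" .
    qed
    have "\<gamma> (sup_norm_before ?v t) \<le> \<gamma> (\<kappa> * (K * exp (- T / 2) * ?s))"
      using sup_norm_before_le[of ?v, OF v] by (intro class_K_mono[OF \<beta>\<gamma>(2)]) auto
    moreover have "infdist (x (T + t) $ r) W
        \<le> max (\<beta> (infdist (x T $ r) W) t) (\<gamma> (sup_norm_before ?v t))"
      using \<beta>\<gamma>(3)[OF reference_is_solution(2,1)[OF x T] t] .
    ultimately show "infdist (x (T + t) $ r) W
        \<le> max (\<beta> (infdist (x T $ r) W) t) (\<gamma> (\<kappa> * (K * exp (- T / 2) * ?s)))"
      by linarith
  qed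
qed

text \<open>Stability is the estimate restarted at time 0. For attractivity the order matters:
  \<open>T\<close> is fixed by the \<open>\<gamma>\<close> term before the \<open>\<beta>\<close>
  term, which depends on the state at \<open>T\<close>, is left to decay.\<close>

lemma globally_asymptotically_stable_sync_set:
  "globally_asymptotically_stable G (sync_set W)"
proof -
  obtain \<beta> \<gamma> where \<beta>: "class_KL \<beta>" and \<gamma>: "class_K \<gamma>"
    and iss: "\<And>x0 x T t. is_free_solution G x0 x \<Longrightarrow> 0 \<le> T \<Longrightarrow> 0 \<le> t \<Longrightarrow>
      infdist (x (T + t) $ r) W \<le> max (\<beta> (infdist (x T $ r) W) t)
        (\<gamma> (\<kappa> * (K * exp (- T / 2) * (\<Sum>j\<in>UNIV. norm (x0 $ j - x0 $ r)))))"
    by (rule reference_iss) blast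
  have \<beta>0: "class_K (\<lambda>d. \<beta> d 0)" and \<beta>_mono: "\<And>d t. 0 \<le> d \<Longrightarrow> 0 \<le> t \<Longrightarrow> \<beta> d t \<le> \<beta> d 0"
    and \<beta>_lim: "\<And>d. 0 \<le> d \<Longrightarrow> (\<beta> d \<longlongrightarrow> 0) at_top"
    using \<beta> by (auto simp: class_KL_def monotone_on_def)
  let ?N = "real CARD('n)"
  let ?s = "\<lambda>x0 :: 'a^'n. \<Sum>j\<in>UNIV. norm (x0 $ j - x0 $ r)"
  have s0: "0 \<le> ?s x0" for x0 by (intro sum_nonneg) auto
  have split: "infdist (x t) (sync_set W) \<le> ?N * infdist (x t $ r) W + ?N * (K * exp (- t / 2) * ?s x0)"
    if "is_free_solution G x0 x" "0 \<le> t" for x0 x t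
  proof -
    have "(\<Sum>k\<in>UNIV. norm (x t $ k - x t $ r)) \<le> ?N * (K * exp (- t / 2) * ?s x0)"
      using K(2)[OF that] by (intro sum_bounded_above) auto
    then show ?thesis using infdist_sync_set_le[OF W(1,2), of "x t" r] by linarith
  qed
  have "\<exists>\<delta>>0. \<forall>x0 x. is_free_solution G x0 x \<longrightarrow> infdist x0 (sync_set W) < \<delta> \<longrightarrow>
      (\<forall>t\<ge>0. infdist (x t) (sync_set W) < \<epsilon>)" if "\<epsilon> > 0" for \<epsilon>
  proof -
    \<comment> \<open>\<open>h d\<close> bounds the distance at all times for initial distance
      \<open>d\<close>, with \<open>2 * ?N * d\<close> bounding the initial spread; continuity and
      \<open>h 0 = 0\<close> then give the radius.\<close>
    define h where "h d = ?N * max (\<beta> d 0) (\<gamma> (\<kappa> * (K * (2 * ?N * d)))) + ?N * (K * (2 * ?N * d))" for d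
    have "continuous_on {0..} (\<lambda>d. \<beta> d 0)"
      using \<beta>0 by (simp add: class_K_def)
    moreover have "continuous_on {0..} (\<lambda>d. \<gamma> (\<kappa> * (K * (2 * ?N * d))))"
    proof (rule continuous_on_compose2[of "{0..}" \<gamma>])
      show "continuous_on {0..} \<gamma>" using \<gamma> by (simp add: class_K_def)
      show "continuous_on {0..} (\<lambda>d. \<kappa> * (K * (2 * ?N * d)))" by (intro continuous_intros)
      show "(\<lambda>d. \<kappa> * (K * (2 * ?N * d))) ` {0..} \<subseteq> {0..}" using K(1) \<kappa>(1) by auto
    qed
    ultimately have "continuous_on {0..} h"
      unfolding h_def by (intro continuous_on_add continuous_on_mult continuous_on_max
          continuous_on_const continuous_on_id)
    then obtain \<delta> where \<delta>': "\<delta> > 0" "\<And>d. d \<in> {0..} \<Longrightarrow> dist d 0 < \<delta> \<Longrightarrow> dist (h d) (h 0) < \<epsilon>"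
      using \<open>\<epsilon> > 0\<close> unfolding continuous_on_iff by (meson atLeast_iff order_refl)
    have "h 0 = 0" using \<beta>0 \<gamma> by (simp add: h_def class_K_def)
    then have \<delta>: "\<delta> > 0" "\<And>d. 0 \<le> d \<Longrightarrow> d < \<delta> \<Longrightarrow> h d < \<epsilon>"
      using \<delta>' by (force simp: dist_real_def)+
    have "infdist (x t) (sync_set W) < \<epsilon>"
      if x: "is_free_solution G x0 x" and d: "infdist x0 (sync_set W) < \<delta>" and t: "0 \<le> t" for x0 x t
    proof -
      let ?d = "infdist x0 (sync_set W)"
      have "x 0 = x0" using x by (simp add: is_solution_def)
      have rd: "infdist (x0 $ r) W \<le> ?d" and sd: "?s x0 \<le> 2 * ?N * ?d"
        using le_infdist_sync_set[OF W(1,2), of x0 r] by auto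
      have "\<beta> (infdist (x0 $ r) W) t \<le> \<beta> ?d 0"
        using \<beta>_mono[of "infdist (x0 $ r) W" t] class_K_mono[OF \<beta>0 _ rd] t by (force simp: infdist_nonneg)
      moreover have "\<gamma> (\<kappa> * (K * ?s x0)) \<le> \<gamma> (\<kappa> * (K * (2 * ?N * ?d)))"
        using K(1) \<kappa>(1) s0[of x0] sd by (intro class_K_mono[OF \<gamma>] mult_left_mono) auto
      moreover have "infdist (x t $ r) W \<le> max (\<beta> (infdist (x0 $ r) W) t) (\<gamma> (\<kappa> * (K * ?s x0)))"
        using iss[OF x order_refl t] \<open>x 0 = x0\<close> by simp
      ultimately have "infdist (x t $ r) W \<le> max (\<beta> ?d 0) (\<gamma> (\<kappa> * (K * (2 * ?N * ?d))))"
        by linarith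
      then have "?N * infdist (x t $ r) W \<le> ?N * max (\<beta> ?d 0) (\<gamma> (\<kappa> * (K * (2 * ?N * ?d))))"
        by (intro mult_left_mono) auto
      moreover have "?N * (K * exp (- t / 2) * ?s x0) \<le> ?N * (K * 1 * (2 * ?N * ?d))"
        using K(1) t sd s0[of x0] by (intro mult_left_mono mult_mono) auto
      ultimately have "infdist (x t) (sync_set W) \<le> h ?d"
        using split[OF x t] unfolding h_def mult_1_right by linarith
      then show ?thesis using \<delta>(2)[OF infdist_nonneg d] by simp
    qed
    then show ?thesis using \<delta>(1) by blast
  qed
  moreover have "((\<lambda>t. infdist (x t) (sync_set W)) \<longlongrightarrow> 0) at_top"
    if x: "is_free_solution G x0 x" for x0 x
  proof -
    define M where "M T = \<kappa> * (K * exp (- T / 2) * ?s x0)" for T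
    have exp0: "((\<lambda>T. exp (- T / 2)) \<longlongrightarrow> 0) (at_top :: real filter)"
      by real_asymp
    have M0: "(M \<longlongrightarrow> 0) at_top"
      unfolding M_def using tendsto_mult_right_zero exp0
      by (auto intro!: tendsto_mult_right_zero tendsto_mult_left_zero)
    have "((\<lambda>T. \<gamma> (M T)) \<longlongrightarrow> \<gamma> 0) at_top"
      using \<gamma> K(1) \<kappa>(1) s0[of x0] by (intro continuous_on_tendsto_compose[OF _ M0]) (auto simp: class_K_def M_def)
    then have \<gamma>M: "((\<lambda>T. \<gamma> (M T)) \<longlongrightarrow> 0) at_top"
      using \<gamma> by (simp add: class_K_def)
    have "((\<lambda>t. infdist (x t $ r) W) \<longlongrightarrow> 0) at_top"
    proof (rule tendstoI)
      fix e :: real assume "e > 0"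
      then have "eventually (\<lambda>T. \<gamma> (M T) < e \<and> 0 \<le> T) at_top"
        using order_tendstoD(2)[OF \<gamma>M] eventually_ge_at_top by (intro eventually_conj) auto
      then obtain T where T: "\<gamma> (M T) < e" "0 \<le> T"
        using eventually_happens'[OF trivial_limit_at_top_linorder] by blast
      have "eventually (\<lambda>t. \<beta> (infdist (x T $ r) W) t < e) at_top"
        using order_tendstoD(2)[OF \<beta>_lim] infdist_nonneg \<open>e > 0\<close> by blast
      then obtain t0 where t0: "\<And>t. t \<ge> t0 \<Longrightarrow> \<beta> (infdist (x T $ r) W) t < e"
        by (auto simp: eventually_at_top_linorder)
      have "dist (infdist (x t $ r) W) 0 < e" if "t \<ge> T + max 0 t0" for t
      proof -
        have "0 \<le> t - T" "t0 \<le> t - T" using that by auto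
        from iss[OF x T(2) this(1)] t0[OF this(2)] T(1)
        have "infdist (x t $ r) W < e" unfolding M_def by (simp del: minus_divide_left)
        then show ?thesis by (simp add: infdist_nonneg)
      qed
      then show "eventually (\<lambda>t. dist (infdist (x t $ r) W) 0 < e) at_top"
        by (auto simp: eventually_at_top_linorder)
    qed
    then have "((\<lambda>t. ?N * infdist (x t $ r) W + ?N * (K * exp (- t / 2) * ?s x0)) \<longlongrightarrow> 0) at_top"
      using exp0 by (auto intro!: tendsto_add_zero tendsto_mult_right_zero tendsto_mult_left_zero)
    then show ?thesis
    proof (rule tendsto_sandwich[OF _ _ tendsto_const, rotated 2])
      show "eventually (\<lambda>t. infdist (x t) (sync_set W)
          \<le> ?N * infdist (x t $ r) W + ?N * (K * exp (- t / 2) * ?s x0)) at_top"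
        using eventually_ge_at_top[of 0] by eventually_elim (rule split[OF x])
    qed (simp add: infdist_nonneg)
  qed
  ultimately show ?thesis
    unfolding globally_asymptotically_stable_def using solvable by blast
qed

end

section \<open>Lipschitz and coupling bounds for the network field\<close>

lemma lipschitz_on_vec:
  fixes f :: "'a::metric_space \<Rightarrow> 'b::real_normed_vector^'n"
  assumes "\<And>k. \<exists>L. L-lipschitz_on U (\<lambda>x. f x $ k)"
  shows "\<exists>L. L-lipschitz_on U f"
proof -
  obtain L where L: "\<And>k. (L k)-lipschitz_on U (\<lambda>x. f x $ k)" using assms by metis
  have "(\<Sum>k\<in>UNIV. L k)-lipschitz_on U f"
  proof (rule lipschitz_onI)
    fix x y assume "x \<in> U" "y \<in> U"
    have "dist (f x) (f y) \<le> (\<Sum>k\<in>UNIV. dist (f x $ k) (f y $ k))"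
      using norm_vec_le_sum[of "f x - f y"] by (simp add: dist_norm)
    also have "\<dots> \<le> (\<Sum>k\<in>UNIV. L k * dist x y)"
      by (intro sum_mono lipschitz_onD[OF L] \<open>x \<in> U\<close> \<open>y \<in> U\<close>)
    finally show "dist (f x) (f y) \<le> (\<Sum>k\<in>UNIV. L k) * dist x y"
      by (simp add: sum_distrib_right)
  qed (intro sum_nonneg lipschitz_on_nonneg[OF L])
  then show ?thesis by blast
qed

context synchronization
begin

lemma lipschitz_field: "\<exists>L. L-lipschitz_on UNIV (field g)"
proof (rule lipschitz_on_vec)
  fix k
  define T where "T w = S_mat *v (w $ k)
    - ((laplacian A *v (\<chi> j. c_vec \<bullet> w $ j)) $ k) *\<^sub>R (D_mat g *v (P *v c_vec))" for w
  have "linear T"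
  proof (rule linearI)
    fix v w :: "(real^('d::{finite,linorder}))^'n" and b :: real
    have "(\<chi> j. c_vec \<bullet> (v + w) $ j) = (\<chi> j. c_vec \<bullet> v $ j) + (\<chi> j. c_vec \<bullet> w $ j)"
      by (simp add: vec_eq_iff inner_add_right)
    then show "T (v + w) = T v + T w"
      by (simp add: T_def matrix_vector_right_distrib algebra_simps)
    have "(\<chi> j. c_vec \<bullet> (b *\<^sub>R w) $ j) = b *\<^sub>R (\<chi> j. c_vec \<bullet> w $ j)"
      by (simp add: vec_eq_iff)
    then show "T (b *\<^sub>R w) = b *\<^sub>R T w"
      by (simp add: T_def matrix_vector_mult_scaleR algebra_simps)
  qed
  then have "bounded_linear T" by (simp add: linear_conv_bounded_linear)
  then obtain K where T: "K-lipschitz_on UNIV T"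
    by (rule bounded_linear.lipschitz_boundE) blast
  have "(\<Lambda> * norm (b_vec :: real^('d::{finite,linorder})))-lipschitz_on UNIV
    (\<lambda>w :: (real^('d::{finite,linorder}))^'n. \<phi> (w $ k) *\<^sub>R (b_vec :: real^('d::{finite,linorder})))"
  proof (rule lipschitz_onI)
    fix v w :: "(real^('d::{finite,linorder}))^'n"
    have "dist (\<phi> (v $ k)) (\<phi> (w $ k)) \<le> \<Lambda> * dist v w"
      using lipschitz_onD[OF lipschitz, of "v $ k" "w $ k"] lipschitz_on_nonneg[OF lipschitz]
      by (meson UNIV_I dist_vec_nth_le mult_left_mono order_trans)
    from mult_right_mono[OF this norm_ge_zero]
    show "dist (\<phi> (v $ k) *\<^sub>R (b_vec :: real^('d::{finite,linorder}))) (\<phi> (w $ k) *\<^sub>R b_vec)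
      \<le> \<Lambda> * norm (b_vec :: real^('d::{finite,linorder})) * dist v w"
      by (simp add: dist_norm mult_ac flip: scaleR_left_diff_distrib)
  qed (simp add: lipschitz_on_nonneg[OF lipschitz])
  from lipschitz_on_add[OF T this]
  have "\<exists>L. L-lipschitz_on UNIV (\<lambda>w. T w + \<phi> (w $ k) *\<^sub>R b_vec)"
    by blast
  then show "\<exists>L. L-lipschitz_on UNIV (\<lambda>w. field g w $ k)"
    by (simp add: field_def network_field_component[OF graph] agent_field_eq T_def algebra_simps)
qed

text \<open>Supplies the constant \<open>\<kappa>\<close> of the locale
  \<open>synchronizing\<close>: the coupling at \<open>r\<close> sees only output differences to
  \<open>r\<close>. The constant may depend on \<open>g\<close>.\<close>

lemma coupling_bound:
  assumes "\<And>j. norm (w $ j - w $ r) \<le> e"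
  shows "norm (field g w $ r - agent_field \<phi> (w $ r))
    \<le> (\<Sum>j\<in>UNIV. A $ r $ j * norm (c_vec :: real^('d::{finite,linorder})))
        * norm (D_mat g *v (P *v c_vec)) * e"
proof -
  have "\<bar>(laplacian A *v (\<chi> j. c_vec \<bullet> w $ j)) $ r\<bar>
      \<le> (\<Sum>j\<in>UNIV. \<bar>A $ r $ j * (c_vec \<bullet> w $ r - c_vec \<bullet> w $ j)\<bar>)"
    by (simp add: laplacian_mult[OF graph])
  also have "\<dots> \<le> (\<Sum>j\<in>UNIV. A $ r $ j * (norm (c_vec :: real^('d::{finite,linorder})) * e))"
  proof (rule sum_mono)
    fix j
    have "\<bar>c_vec \<bullet> w $ r - c_vec \<bullet> w $ j\<bar> \<le> norm (c_vec :: real^('d::{finite,linorder})) * norm (w $ r - w $ j)"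
      by (metis Cauchy_Schwarz_ineq2 inner_diff_right)
    also have "\<dots> \<le> norm (c_vec :: real^('d::{finite,linorder})) * e"
      using assms[of j] by (intro mult_left_mono) (auto simp: norm_minus_commute)
    finally show "\<bar>A $ r $ j * (c_vec \<bullet> w $ r - c_vec \<bullet> w $ j)\<bar>
        \<le> A $ r $ j * (norm (c_vec :: real^('d::{finite,linorder})) * e)"
      using graph by (simp add: comm_graph_def abs_mult mult_left_mono)
  qed
  finally have "\<bar>(laplacian A *v (\<chi> j. c_vec \<bullet> w $ j)) $ r\<bar>
      \<le> (\<Sum>j\<in>UNIV. A $ r $ j * (norm (c_vec :: real^('d::{finite,linorder})) * e))" .
  then have "\<bar>(laplacian A *v (\<chi> j. c_vec \<bullet> w $ j)) $ r\<bar> * norm (D_mat g *v (P *v c_vec))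
      \<le> (\<Sum>j\<in>UNIV. A $ r $ j * (norm (c_vec :: real^('d::{finite,linorder})) * e))
        * norm (D_mat g *v (P *v c_vec))"
    by (rule mult_right_mono) simp
  then show ?thesis
    by (simp add: field_def network_field_component[OF graph] sum_distrib_left sum_distrib_right mult_ac)
qed

lemma exists_stabilizing_gain:
  assumes "W \<noteq> {}" "compact W" "invariant_set (agent_field \<phi>) W" "iss_relative (agent_field \<phi>) W"
  shows "\<exists>g0>0. \<forall>g\<ge>g0. invariant_set (field g) (sync_set W) \<and>
    globally_asymptotically_stable (field g) (sync_set W)"
proof -
  obtain g0 where g0: "g0 \<ge> 1"
    and decay: "\<And>g. g \<ge> g0 \<Longrightarrow> \<exists>K>0. \<forall>w0 w t k. is_free_solution (field g) w0 w \<longrightarrow> 0 \<le> t \<longrightarrow>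
      norm (w t $ k - w t $ r) \<le> K * exp (- t / 2) * (\<Sum>j\<in>UNIV. norm (w0 $ j - w0 $ r))"
    by (rule synchronization_error_decay) blast
  have "invariant_set (field g) (sync_set W) \<and> globally_asymptotically_stable (field g) (sync_set W)"
    if g: "g \<ge> g0" for g
  proof -
    obtain K where K: "K > 0"
      "\<And>w0 w t k. is_free_solution (field g) w0 w \<Longrightarrow> 0 \<le> t \<Longrightarrow>
        norm (w t $ k - w t $ r) \<le> K * exp (- t / 2) * (\<Sum>j\<in>UNIV. norm (w0 $ j - w0 $ r))"
      using decay[OF g] by blast
    obtain L where L: "L-lipschitz_on UNIV (field g)" using lipschitz_field by blast
    have "continuous_on UNIV \<phi>" using lipschitz by (rule lipschitz_on_continuous_on)
    then have F: "continuous_on UNIV (agent_field \<phi>)"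
      unfolding agent_field_eq[abs_def]
      by (intro continuous_on_add continuous_on_scaleR continuous_on_const
          linear_continuous_on[OF matrix_vector_mul_bounded_linear])
    interpret synchronizing "agent_field \<phi>" "field g" W r K
      "(\<Sum>j\<in>UNIV. A $ r $ j * norm (c_vec :: real^('d::{finite,linorder}))) * norm (D_mat g *v (P *v c_vec))"
    proof
      show "0 \<le> (\<Sum>j\<in>UNIV. A $ r $ j * norm (c_vec :: real^('d::{finite,linorder})))
          * norm (D_mat g *v (P *v c_vec))"
        using graph by (intro mult_nonneg_nonneg sum_nonneg) (auto simp: comm_graph_def)
    qed (use assms F K lipschitz_on_continuous_on[OF L] lipschitz_exists_free_solution[OF L]
        coupling_bound in auto)
    show ?thesis
      using invariant_sync_set globally_asymptotically_stable_sync_set by blast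
  qed
  then show ?thesis using g0 by (intro exI[of _ g0]) auto
qed

end

section \<open>Choice of the reference node and of the rate\<close>

theorem proposition1:
  fixes E :: "('n::finite \<times> 'n) set"
    and A :: "real^'n^'n"
    and \<phi> :: "real^('d::{finite,linorder}) \<Rightarrow> real"
    and W :: "(real^('d::{finite,linorder})) set"
    and \<mu> a :: real
    and P :: "real^('d::{finite,linorder})^('d::{finite,linorder})"
    and K0 :: "real^1^('d::{finite,linorder})"
  assumes graph: "comm_graph E A"
    and lipschitz: "\<exists>\<Lambda>. \<Lambda>-lipschitz_on UNIV \<phi>"
    and connected: "graph_connected E"
    and W: "W \<noteq> {}" "compact W" "invariant_set (agent_field \<phi>) W"
    and iss: "iss_relative (agent_field \<phi>) W"
    and \<mu>: "\<mu> > 0" "\<forall>z\<in>#other_eigenvalues A. Re z \<ge> \<mu>"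
    and a: "a > 0"
    and P: "pos_def_symmetric P"
    and riccati: "S_mat ** P + P ** transpose S_mat
      - (2 * \<mu>) *\<^sub>R (P ** transpose C_mat ** C_mat ** P) + a *\<^sub>R mat 1 = 0"
    and K0: "K0 = P ** transpose C_mat"
  shows "\<exists>g_star>0. \<forall>g\<ge>g_star.
    compact (sync_set W :: ((real^('d::{finite,linorder}))^'n) set) \<and>
    invariant_set (network_field \<phi> A K0 g) (sync_set W) \<and>
    globally_asymptotically_stable (network_field \<phi> A K0 g) (sync_set W)"
proof -
  obtain \<Lambda> where \<Lambda>: "\<Lambda>-lipschitz_on UNIV \<phi>" using lipschitz by blast
  obtain R where R: "P ** R = mat 1" by (rule pos_def_symmetric_right_inverse[OF P])
  \<comment> \<open>Any node can serve as reference, since the spectral bound for the deflated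
    matrix holds for each \<open>r\<close>.\<close>
  obtain r :: 'n where True by simp
  let ?p = "(norm (P *v c_vec))\<^sup>2"
  \<comment> \<open>Solved backwards from \<open>gap\<close>:
    \<open>4 * (\<mu> - \<mu>') * ?p\<close> equals \<open>a * ?p / (?p + 1)\<close>, which is at
    most \<open>a\<close>, while \<open>\<mu>'\<close> stays strictly below
    \<open>\<mu>\<close>.\<close>
  define e where "e = a / (?p + 1)"
  define \<mu>' where "\<mu>' = \<mu> - e / 4"
  have p: "0 < ?p + 1" by (simp add: add_nonneg_pos)
  then have "\<mu>' < \<mu>" using a by (simp add: \<mu>'_def e_def)
  have eig: "\<mu> \<le> Re l" if "det (mat l - map_matrix complex_of_real (deflated A r \<mu>)) = 0" for l
    by (rule deflated_eigenvalue_bound[OF graph connected \<mu>(2) that])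
  obtain N u c where u: "lyapunov_family (deflated A r \<mu>) \<mu>' N u"
    and c: "c > 0" "\<And>x. (norm x)\<^sup>2 \<le> c * (\<Sum>m<N. (u m \<bullet> x)\<^sup>2)"
    by (rule exists_lyapunov_family[OF eig \<open>\<mu>' < \<mu>\<close>]) blast+
  have "4 * (\<mu> - \<mu>') * ?p = e * ?p" by (simp add: \<mu>'_def)
  also have "\<dots> = a * ?p / (?p + 1)" by (simp add: e_def)
  also have "\<dots> \<le> a"
    using a p by (simp add: divide_le_eq algebra_simps)
  finally have gap: "4 * (\<mu> - \<mu>') * ?p \<le> a" .
  interpret synchronization E A \<phi> P R r \<mu> \<mu>' a \<Lambda> c N u
    by unfold_locales (use graph \<Lambda> a P riccati R u c gap in auto)
  show ?thesis
    using exists_stabilizing_gain[OF W iss] compact_sync_set[OF W(2)]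
    unfolding field_def K0 by blast
qed

end
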